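(* The class of circle graphs is not induced-tw-bounded.
   Context: A chord of a circle is a closed line segment with distinct endpoints on the circle; two chords cross if they intersect at a point other than an endpoint of either. A circle graph is a graph isomorphic to the graph whose vertices are the chords of a finite set of chords of a circle (no three crossing at one point), two chords adjacent iff they cross. A hereditary class $\mathcal{G}$ (closed under isomorphism and induced subgraphs) is induced-tw-bounded if there is a function $f$ such that every $G\in\mathcal{G}$ with $\operatorname{tw}(G)\ge f(t)$ contains, as an induced subgraph, one of: $K_t$; $K_{t,t}$; a subdivision of the $(t\times t)$-wall; or the line graph of a subdivision of the $(t\times t)$-wall. Here the $(t\times t)$-wall is the standard elementary wall: start from the grid with vertices $(i,j)$, $1\le i\le t$, $1\le j\le 2t$, with $(i,j)$ adjacent to $(i,j+1)$ and $(i+1,j)$; delete the vertical edges $(i,j)(i+1,j)$ with $i+j$ odd; then delete vertices of degree one. *)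

theory Defs
  imports "HOL-Analysis.Analysis" "Graph_Theory.Graph_Theory"
begin

text \<open>
  A finite simple graph is a \<^locale>\<open>pair_graph\<close>: a finite, symmetric, loop-free set of arcs
  between finitely many vertices, each edge being represented by its two opposite arcs.
\<close>

subsection \<open>Induced subgraphs up to isomorphism, line graphs\<close>

definition contains_induced :: "'a pair_pre_digraph \<Rightarrow> 'b pair_pre_digraph \<Rightarrow> bool" where
  "contains_induced G H \<longleftrightarrow>
     (\<exists>H'. induced_subgraph (with_proj H') (with_proj G) \<and> digraph_iso (with_proj H) (with_proj H'))"

definition line_graph :: "'a pair_pre_digraph \<Rightarrow> 'a set pair_pre_digraph" where
  "line_graph G = (let E = {{u, v} | u v. (u, v) \<in> parcs G} in
     \<lparr>pverts = E, parcs = {(e, e'). e \<in> E \<and> e' \<in> E \<and> e \<noteq> e' \<and> e \<inter> e' \<noteq> {}}\<rparr>)"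

subsection \<open>Treewidth\<close>

text \<open>
  The library predicates \<^const>\<open>forest\<close> and \<^const>\<open>tree\<close> are about directed cycles, and
  the two arcs of a single edge form such a cycle; cycles of an undirected graph have length at
  least three.
\<close>

definition undirected_tree :: "'a pair_pre_digraph \<Rightarrow> bool" where
  "undirected_tree T \<longleftrightarrow> pair_graph T \<and> Digraph_Component.connected (with_proj T) \<and>
     \<not> (\<exists>p. pre_digraph.cycle (with_proj T) p \<and> length p \<ge> 3)"

definition tree_decomposition ::
    "'a pair_pre_digraph \<Rightarrow> 'b pair_pre_digraph \<Rightarrow> ('b \<Rightarrow> 'a set) \<Rightarrow> bool" where
  "tree_decomposition G T B \<longleftrightarrow> undirected_tree T \<and>
     (\<forall>x\<in>pverts T. B x \<subseteq> pverts G) \<and>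
     (\<forall>(u, v)\<in>parcs G. \<exists>x\<in>pverts T. u \<in> B x \<and> v \<in> B x) \<and>
     (\<forall>v\<in>pverts G. Digraph_Component.connected (with_proj T \<restriction> {x \<in> pverts T. v \<in> B x}))"
  \<comment> \<open>Connected graphs are nonempty, so the last clause also says that every vertex is in a bag.\<close>

definition decomposition_width :: "'b pair_pre_digraph \<Rightarrow> ('b \<Rightarrow> 'a set) \<Rightarrow> nat" where
  "decomposition_width T B = Max ((\<lambda>x. card (B x)) ` pverts T) - 1"

text \<open>
  Trees on natural numbers suffice, as every finite tree is isomorphic to one of these. Because of
  truncated subtraction the graph without vertices has treewidth 0 (rather than -1).
\<close>

definition treewidth :: "'a pair_pre_digraph \<Rightarrow> nat" where
  "treewidth G = (LEAST w. \<exists>(T :: nat pair_pre_digraph) B.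
     tree_decomposition G T B \<and> decomposition_width T B = w)"

subsection \<open>Walls\<close>

definition wall_grid :: "nat \<Rightarrow> (nat \<times> nat) pair_pre_digraph" where
  "wall_grid t = (let V = {1..t} \<times> {1..2 * t};
       A = {((i, j), (i, j + 1)) | i j. True} \<union> {((i, j), (i + 1, j)) | i j. True}
     in \<lparr>pverts = V, parcs = (A \<union> A\<inverse>) \<inter> V \<times> V\<rparr>)"

definition wall_with_pendants :: "nat \<Rightarrow> (nat \<times> nat) pair_pre_digraph" where
  "wall_with_pendants t = (let D = {((i, j), (i + 1, j)) | i j. odd (i + j)}
     in \<lparr>pverts = pverts (wall_grid t), parcs = parcs (wall_grid t) - (D \<union> D\<inverse>)\<rparr>)"

definition wall :: "nat \<Rightarrow> (nat \<times> nat) pair_pre_digraph" where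
  "wall t = (let W = wall_with_pendants t; V = {v \<in> pverts W. out_degree (with_proj W) v \<noteq> 1}
     in \<lparr>pverts = V, parcs = parcs W \<inter> V \<times> V\<rparr>)"

subsection \<open>Circle graphs\<close>

definition is_chord :: "complex \<Rightarrow> real \<Rightarrow> complex set \<Rightarrow> bool" where
  "is_chord c r C \<longleftrightarrow> (\<exists>a\<in>sphere c r. \<exists>b\<in>sphere c r. a \<noteq> b \<and> C = closed_segment a b)"

definition is_endpoint :: "complex \<Rightarrow> complex set \<Rightarrow> bool" where
  "is_endpoint a C \<longleftrightarrow> (\<exists>b. C = closed_segment a b)"

definition cross_at :: "complex set \<Rightarrow> complex set \<Rightarrow> complex \<Rightarrow> bool" where
  "cross_at C D p \<longleftrightarrow> C \<noteq> D \<and> p \<in> C \<inter> D \<and> \<not> is_endpoint p C \<and> \<not> is_endpoint p D"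

definition crossing_graph :: "complex set set \<Rightarrow> complex set pair_pre_digraph" where
  "crossing_graph S = \<lparr>pverts = S, parcs = {(C, D). C \<in> S \<and> D \<in> S \<and> (\<exists>p. cross_at C D p)}\<rparr>"

definition circle_graph :: "'a pair_pre_digraph \<Rightarrow> bool" where
  "circle_graph G \<longleftrightarrow> (\<exists>c r S. r > 0 \<and> finite S \<and> (\<forall>C\<in>S. is_chord c r C) \<and>
     \<not> (\<exists>C\<in>S. \<exists>D\<in>S. \<exists>E\<in>S. \<exists>p. cross_at C D p \<and> cross_at D E p \<and> cross_at C E p) \<and>
     digraph_iso (with_proj (crossing_graph S)) (with_proj G))"

text \<open>
  A class of graphs is represented by its members with vertices in \<^typ>\<open>nat\<close>; every finite graph
  has an isomorphic copy of this kind.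
\<close>

definition circle_graphs :: "nat pair_pre_digraph set" where
  "circle_graphs = {G. circle_graph G}"

subsection \<open>Induced-tw-bounded classes\<close>

definition hereditary :: "nat pair_pre_digraph set \<Rightarrow> bool" where
  "hereditary \<G> \<longleftrightarrow>
     (\<forall>G\<in>\<G>. \<forall>H. digraph_iso (with_proj G) (with_proj H) \<longrightarrow> H \<in> \<G>) \<and>
     (\<forall>G\<in>\<G>. \<forall>H. induced_subgraph (with_proj H) (with_proj G) \<longrightarrow> H \<in> \<G>)"

text \<open>
  The notion is meant for hereditary classes only. Heredity is not a conjunct here, so that the
  negation of this predicate is not satisfied merely by failure of heredity; the class of circle
  graphs is shown to be hereditary below.
\<close>

definition induced_tw_bounded :: "nat pair_pre_digraph set \<Rightarrow> bool" where
  "induced_tw_bounded \<G> \<longleftrightarrow> (\<exists>f :: nat \<Rightarrow> nat. \<forall>t. \<forall>G\<in>\<G>. treewidth G \<ge> f t \<longrightarrow>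
     (\<exists>H. induced_subgraph (with_proj H) (with_proj G) \<and> K\<^bsub>t\<^esub> (with_proj H)) \<or>
     (\<exists>H. induced_subgraph (with_proj H) (with_proj G) \<and> K\<^bsub>t,t\<^esub> (with_proj H)) \<or>
     (\<exists>W. subdivision_pair (wall t) W \<and> contains_induced G W) \<or>
     (\<exists>W. subdivision_pair (wall t) W \<and> contains_induced G (line_graph W)))"

lemma digraph_iso_pair_iff:
  "digraph_iso (with_proj G) (with_proj H) \<longleftrightarrow> pair_wf_digraph G \<and>
     (\<exists>f. inj_on f (pverts G) \<and> pverts H = f ` pverts G \<and> parcs H = map_prod f f ` parcs G)"
  (is "?L \<longleftrightarrow> ?R")
proof
  assume ?L
  then obtain h where h: "pre_digraph.digraph_isomorphism (with_proj G) h"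
    and H: "with_proj H = app_iso h (with_proj G)"
    by (auto simp: digraph_iso_def)
  have ht: "iso_tail h = fst" "iso_head h = snd"
    using H by (metis tail_app_iso with_proj_simps(4), metis head_app_iso with_proj_simps(5))
  have a: "iso_arcs h a = map_prod (iso_verts h) (iso_verts h) a" if "a \<in> parcs G" for a
    using h that ht by (cases a) (auto simp: pre_digraph.digraph_isomorphism_def prod_eq_iff)
  have "pverts H = iso_verts h ` pverts G" "parcs H = iso_arcs h ` parcs G"
    using H by (metis verts_app_iso with_proj_simps(1), metis arcs_app_iso with_proj_simps(2))
  moreover have "iso_arcs h ` parcs G = map_prod (iso_verts h) (iso_verts h) ` parcs G"
    using a by (intro image_cong) auto
  ultimately show ?R
    using h by (auto simp: pre_digraph.digraph_isomorphism_def wf_digraph_wp_iff)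
next
  assume ?R
  then obtain f where wf: "pair_wf_digraph G" and f: "inj_on f (pverts G)"
    and H: "pverts H = f ` pverts G" "parcs H = map_prod f f ` parcs G" by auto
  interpret pair_wf_digraph G by fact
  let ?h = "\<lparr>iso_verts = f, iso_arcs = map_prod f f, iso_head = snd, iso_tail = fst\<rparr>"
  have "inj_on (map_prod f f) (parcs G)"
    by (rule inj_on_subset[OF map_prod_inj_on[OF f f]]) (auto dest: in_arcsD1 in_arcsD2)
  then have "pre_digraph.digraph_isomorphism (with_proj G) ?h"
    using f wf by (auto simp: pre_digraph.digraph_isomorphism_def wf_digraph_wp_iff)
  moreover have "with_proj H = app_iso ?h (with_proj G)"
    by (auto simp: app_iso_def with_proj_def H)
  ultimately show ?L by (auto simp: digraph_iso_def)
qed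

lemma induced_subgraph_pair_iff:
  "induced_subgraph (with_proj H) (with_proj G) \<longleftrightarrow> pair_wf_digraph G \<and>
     pverts H \<subseteq> pverts G \<and> parcs H = parcs G \<inter> pverts H \<times> pverts H"
proof -
  have arcs: "{e \<in> parcs G. fst e \<in> pverts H \<and> snd e \<in> pverts H} = parcs G \<inter> pverts H \<times> pverts H"
    by (auto simp: mem_Times_iff)
  have "pair_wf_digraph H" if "parcs H = parcs G \<inter> pverts H \<times> pverts H"
    unfolding pair_wf_digraph_def that by (simp add: mem_Times_iff)
  then show ?thesis
    unfolding induced_subgraph_def subgraph_def wf_digraph_wp_iff compatible_def
      with_proj_simps arcs by blast
qed

lemma hereditary_circle_graphs: "hereditary circle_graphs"
  unfolding hereditary_def
proof (intro conjI ballI allI impI)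
  fix G H :: "nat pair_pre_digraph"
  assume "G \<in> circle_graphs" and GH: "digraph_iso (with_proj G) (with_proj H)"
  then obtain c r S where S: "r > 0" "finite S" "\<forall>C\<in>S. is_chord c r C"
    "\<not> (\<exists>C\<in>S. \<exists>D\<in>S. \<exists>E\<in>S. \<exists>p. cross_at C D p \<and> cross_at D E p \<and> cross_at C E p)"
    and SG: "digraph_iso (with_proj (crossing_graph S)) (with_proj G)"
    unfolding circle_graphs_def circle_graph_def by auto
  from SG obtain f where f: "pair_wf_digraph (crossing_graph S)"
    "inj_on f (pverts (crossing_graph S))" "pverts G = f ` pverts (crossing_graph S)"
    "parcs G = map_prod f f ` parcs (crossing_graph S)" unfolding digraph_iso_pair_iff by blast
  from GH obtain g where g: "inj_on g (pverts G)" "pverts H = g ` pverts G"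
    "parcs H = map_prod g g ` parcs G" unfolding digraph_iso_pair_iff by blast
  have "inj_on (g \<circ> f) (pverts (crossing_graph S))" using f g by (simp add: comp_inj_on)
  moreover have "pverts H = (g \<circ> f) ` pverts (crossing_graph S)" using f g by (simp add: image_comp)
  moreover have "parcs H = map_prod (g \<circ> f) (g \<circ> f) ` parcs (crossing_graph S)"
    using f g by (simp add: image_comp map_prod_compose)
  ultimately have "digraph_iso (with_proj (crossing_graph S)) (with_proj H)"
    using f(1) unfolding digraph_iso_pair_iff by blast
  then show "H \<in> circle_graphs"
    unfolding circle_graphs_def circle_graph_def using S by blast
next
  fix G H :: "nat pair_pre_digraph"
  assume "G \<in> circle_graphs" and HG: "induced_subgraph (with_proj H) (with_proj G)"
  then obtain c r S where S: "r > 0" "finite S" "\<forall>C\<in>S. is_chord c r C"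
    "\<not> (\<exists>C\<in>S. \<exists>D\<in>S. \<exists>E\<in>S. \<exists>p. cross_at C D p \<and> cross_at D E p \<and> cross_at C E p)"
    and SG: "digraph_iso (with_proj (crossing_graph S)) (with_proj G)"
    unfolding circle_graphs_def circle_graph_def by auto
  from SG obtain f where f: "inj_on f S" "pverts G = f ` S"
    "parcs G = map_prod f f ` parcs (crossing_graph S)"
    unfolding digraph_iso_pair_iff by (auto simp: crossing_graph_def)
  have H: "pverts H \<subseteq> pverts G" "parcs H = parcs G \<inter> pverts H \<times> pverts H"
    using HG unfolding induced_subgraph_pair_iff by auto
  define S' where "S' = {C \<in> S. f C \<in> pverts H}"
  have "S' \<subseteq> S" by (auto simp: S'_def)
  have "inj_on f S'" using f(1) \<open>S' \<subseteq> S\<close> by (rule inj_on_subset)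
  moreover have "pverts H = f ` S'" using H(1) f(2) by (auto simp: S'_def)
  moreover have "parcs H = map_prod f f ` parcs (crossing_graph S')"
    unfolding H(2) f(3) by (auto simp: crossing_graph_def S'_def)
  moreover have "pair_wf_digraph (crossing_graph S')"
    by unfold_locales (auto simp: crossing_graph_def)
  moreover have "pverts (crossing_graph S') = S'" by (simp add: crossing_graph_def)
  ultimately have "digraph_iso (with_proj (crossing_graph S')) (with_proj H)"
    unfolding digraph_iso_pair_iff by metis
  moreover have "finite S'" using S(2) \<open>S' \<subseteq> S\<close> by (rule rev_finite_subset)
  moreover have "\<forall>C\<in>S'. is_chord c r C" using S(3) \<open>S' \<subseteq> S\<close> by blast
  moreover have "\<not> (\<exists>C\<in>S'. \<exists>D\<in>S'. \<exists>E\<in>S'. \<exists>p. cross_at C D p \<and> cross_at D E p \<and> cross_at C E p)"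
    using S(4) \<open>S' \<subseteq> S\<close> by blast
  ultimately show "H \<in> circle_graphs"
    unfolding circle_graphs_def circle_graph_def using S(1) by blast
qed

end

theory Submission
  imports Defs
begin

text \<open>
  Draw chords in levels: each new level is a chain of short chords running past all endpoints drawn
  so far, consecutive chords of the chain crossing each other and each of them enclosing exactly one
  old endpoint. Every level is connected and any two levels are joined by an edge, so the levels
  form a bramble of disjoint sets and the treewidth grows with the number of levels. A chord crosses
  at most two chords of its own level and one of all earlier levels, so the graphs are 3-degenerate
  and contain neither \<open>K\<^sub>5\<close> nor \<open>K\<^sub>5\<^sub>,\<^sub>5\<close>.

  No circle graph contains a large subdivided wall or the line graph of one. Let \<open>P\<close> be a brick, \<open>Q\<close>
  a connected piece of the wall far from it, and \<open>m\<^sub>1, m\<^sub>2, m\<^sub>3\<close> connections between the two.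
  The chords of \<open>P\<close> and those of \<open>Q\<close> occupy disjoint arcs, so each \<open>m\<^sub>i\<close> has exactly one end
  \<open>x\<^sub>i\<close> in the arc of \<open>P\<close>, and \<open>m\<^sub>i\<close> crosses those chords of \<open>P\<close> that enclose \<open>x\<^sub>i\<close>. If \<open>x\<^sub>2\<close> is the
  middle one of these ends, then \<open>P\<close> without the neighbours of \<open>m\<^sub>2\<close> is still connected and has chords on
  both sides of \<open>x\<^sub>2\<close>, so one of them encloses \<open>x\<^sub>2\<close>: a contradiction.
\<close>

subsection \<open>Connectedness and degeneracy\<close>

text \<open>Whether two chords cross depends only on the cyclic order of their ends. All
  combinatorics therefore takes place in \<open>chord_model\<close>, and geometry enters once, when
  such an order is realised by points of a circle. The obstacle there is the ban on three chords
  through one point; it is met by choosing the points generically. The walls to be excluded are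
  subdivided arbitrarily, so no fixed brick survives. The argument needs only connectivity and
  adjacency of three sets: \<open>frame\<close> records a version of these conditions that is
  preserved when a single edge is subdivided, and \<open>obstruction\<close> a weaker one that
  follows from it both for the graph and for its line graph. The single value \<open>t = 5\<close>
  refutes every candidate bound \<open>f\<close>: 3-degeneracy excludes \<open>K\<^sub>5\<close> but
  not \<open>K\<^sub>4\<close>, and the frame chosen in the wall fits once
  \<open>4 \<le> t\<close>.\<close>

text \<open>
  Connectedness of the subgraph induced by \<open>S\<close>, without paths: a predicate that takes the same value
  on adjacent vertices is constant.
\<close>

definition linked :: "('a \<times> 'a) set \<Rightarrow> 'a set \<Rightarrow> bool" where
  "linked E S \<longleftrightarrow> (\<forall>P :: 'a \<Rightarrow> bool. (\<forall>x\<in>S. \<forall>y\<in>S. (x, y) \<in> E \<longrightarrow> P x = P y) \<longrightarrow> (\<forall>x\<in>S. \<forall>y\<in>S. P x = P y))"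

lemma linkedI:
  assumes "\<And>(P :: 'a \<Rightarrow> bool) x y. (\<And>x y. x \<in> S \<Longrightarrow> y \<in> S \<Longrightarrow> (x, y) \<in> E \<Longrightarrow> P x = P y) \<Longrightarrow>
    x \<in> S \<Longrightarrow> y \<in> S \<Longrightarrow> P x = P y"
  shows "linked E S"
  unfolding linked_def by (intro allI impI ballI) (rule assms; blast)

lemma linkedD:
  fixes P :: "'a \<Rightarrow> bool"
  assumes "linked E S" "\<And>x y. x \<in> S \<Longrightarrow> y \<in> S \<Longrightarrow> (x, y) \<in> E \<Longrightarrow> P x = P y" "x \<in> S" "y \<in> S"
  shows "P x = P y"
  using assms unfolding linked_def by blast

lemma linked_neighbour:
  assumes "linked E S" "x \<in> S" "y \<in> S" "x \<noteq> y"
  obtains z where "z \<in> S" "(x, z) \<in> E \<or> (z, x) \<in> E"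
  using linkedD[of E S "\<lambda>z. z = x" x y] assms by blast

lemma linked_mono:
  assumes "linked E S" "\<And>x y. x \<in> S \<Longrightarrow> y \<in> S \<Longrightarrow> (x, y) \<in> E \<Longrightarrow> (x, y) \<in> E'"
  shows "linked E' S"
proof (rule linkedI)
  fix P :: "_ \<Rightarrow> bool" and x y
  assume "\<And>x y. x \<in> S \<Longrightarrow> y \<in> S \<Longrightarrow> (x, y) \<in> E' \<Longrightarrow> P x = P y" "x \<in> S" "y \<in> S"
  with assms show "P x = P y" using linkedD[OF assms(1), of P x y] by blast
qed

lemma linked_insert:
  assumes "linked E S" "s \<in> S" "(w, s) \<in> E"
  shows "linked E (insert w S)"
proof (rule linkedI)
  fix P :: "_ \<Rightarrow> bool" and x y
  assume P: "\<And>x y. x \<in> insert w S \<Longrightarrow> y \<in> insert w S \<Longrightarrow> (x, y) \<in> E \<Longrightarrow> P x = P y"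
    and xy: "x \<in> insert w S" "y \<in> insert w S"
  have S: "P a = P b" if "a \<in> S" "b \<in> S" for a b
    by (rule linkedD[OF assms(1), of P]) (use that P in auto)
  have "P w = P s" using assms P by blast
  then have "P z = P s" if "z \<in> insert w S" for z using that S assms(2) by blast
  then show "P x = P y" using xy by blast
qed

text \<open>The path \<open>u\<close>, \<open>w\<close>, \<open>v\<close> stands in for the edge
  between \<open>u\<close> and \<open>v\<close>, the only one within \<open>S\<close> that may be
  missing from \<open>E'\<close>.\<close>

lemma linked_subdivide:
  assumes "linked E S" "u \<in> S" "v \<in> S"
    and "\<And>x y. x \<in> S \<Longrightarrow> y \<in> S \<Longrightarrow> (x, y) \<in> E \<Longrightarrow> (x, y) \<notin> {(u, v), (v, u)} \<Longrightarrow> (x, y) \<in> E'"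
    and "(u, w) \<in> E'" "(w, v) \<in> E'"
  shows "linked E' (insert w S)"
proof (rule linkedI)
  fix P :: "_ \<Rightarrow> bool" and x y
  assume P: "\<And>x y. x \<in> insert w S \<Longrightarrow> y \<in> insert w S \<Longrightarrow> (x, y) \<in> E' \<Longrightarrow> P x = P y"
    and xy: "x \<in> insert w S" "y \<in> insert w S"
  have w: "P u = P w" "P w = P v" using P assms by auto
  have S: "P a = P b" if "a \<in> S" "b \<in> S" for a b
  proof (rule linkedD[OF assms(1) _ that])
    fix a b assume "a \<in> S" "b \<in> S" "(a, b) \<in> E"
    then show "P a = P b" using w P assms(4)[of a b] by auto
  qed
  have "P z = P u" if "z \<in> insert w S" for z using that S w assms(2) by blast
  then show "P x = P y" using xy by blast
qed

lemma linked_image: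
  assumes "linked E S" "\<And>x y. x \<in> S \<Longrightarrow> y \<in> S \<Longrightarrow> (x, y) \<in> E \<Longrightarrow> (f x, f y) \<in> E'"
  shows "linked E' (f ` S)"
proof (rule linkedI)
  fix P :: "_ \<Rightarrow> bool" and x y
  assume P: "\<And>x y. x \<in> f ` S \<Longrightarrow> y \<in> f ` S \<Longrightarrow> (x, y) \<in> E' \<Longrightarrow> P x = P y" and "x \<in> f ` S" "y \<in> f ` S"
  then obtain a b where ab: "x = f a" "a \<in> S" "y = f b" "b \<in> S" by blast
  have "(P \<circ> f) a = (P \<circ> f) b"
    by (rule linkedD[OF assms(1) _ ab(2,4)]) (use assms(2) P in auto)
  then show "P x = P y" using ab by simp
qed

lemma linked_path:
  assumes "set (vwalk_arcs xs) \<subseteq> E"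
  shows "linked E (set xs)"
  using assms
proof (induction xs rule: vwalk_arcs.induct)
  case (3 x y zs)
  then show ?case using linked_insert[of E "set (y # zs)" y x] by simp
qed (auto simp: linked_def)

text \<open>With \<open>d = 1\<close> this is also the form in which acyclicity of trees is used.
  Finiteness is demanded because \<open>card\<close> is 0 on infinite sets.\<close>

definition degenerate :: "nat \<Rightarrow> ('a \<times> 'a) set \<Rightarrow> 'a set \<Rightarrow> bool" where
  "degenerate d E N \<longleftrightarrow> (\<forall>S\<subseteq>N. S \<noteq> {} \<longrightarrow> (\<exists>v\<in>S. finite (E `` {v} \<inter> S) \<and> card (E `` {v} \<inter> S) \<le> d))"

lemma degenerate_min_degree:
  assumes "degenerate d (parcs G) (pverts G)" "induced_subgraph (with_proj H) (with_proj G)" "pverts H \<noteq> {}"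
  obtains v where "v \<in> pverts H" "finite (parcs H `` {v})" "card (parcs H `` {v}) \<le> d"
proof -
  have H: "pverts H \<subseteq> pverts G" "parcs H = parcs G \<inter> pverts H \<times> pverts H"
    using assms(2) unfolding induced_subgraph_pair_iff by blast+
  obtain v where v: "v \<in> pverts H" "finite (parcs G `` {v} \<inter> pverts H)" "card (parcs G `` {v} \<inter> pverts H) \<le> d"
    using assms(1,3) H(1) unfolding degenerate_def by blast
  have "parcs H `` {v} = parcs G `` {v} \<inter> pverts H" using v(1) unfolding H(2) by blast
  then show ?thesis using that v by metis
qed

lemma degenerate_no_complete:
  assumes "degenerate d (parcs G) (pverts G)" "induced_subgraph (with_proj H) (with_proj G)"
    and "K\<^bsub>t\<^esub> (with_proj H)" "d + 1 < t"
  shows False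
proof -
  have H: "finite (pverts H)" "card (pverts H) = t" "parcs H = {(u, v). (u, v) \<in> pverts H \<times> pverts H \<and> u \<noteq> v}"
    using assms(3) unfolding complete_digraph_pair_def by blast+
  then have "pverts H \<noteq> {}" using assms(4) by auto
  then obtain v where v: "v \<in> pverts H" "card (parcs H `` {v}) \<le> d"
    using degenerate_min_degree[OF assms(1,2)] by blast
  have "parcs H `` {v} = pverts H - {v}" using v(1) unfolding H(3) by blast
  then have "card (parcs H `` {v}) = t - 1" using H v by simp
  then show False using v(2) assms(4) by simp
qed

lemma degenerate_no_complete_bipartite:
  assumes "degenerate d (parcs G) (pverts G)" "induced_subgraph (with_proj H) (with_proj G)"
    and "K\<^bsub>t,t\<^esub> (with_proj H)" "d < t"
  shows False
proof -
  obtain A B where H: "finite (pverts H)" "pverts H = A \<union> B" "A \<inter> B = {}" "card A = t" "card B = t"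
    "parcs H = A \<times> B \<union> B \<times> A"
    using assms(3) unfolding complete_bipartite_digraph_pair_def by blast
  then have "pverts H \<noteq> {}" using assms(4) by auto
  then obtain v where v: "v \<in> pverts H" "card (parcs H `` {v}) \<le> d"
    using degenerate_min_degree[OF assms(1,2)] by blast
  have "parcs H `` {v} = A \<or> parcs H `` {v} = B" using v(1) H(2,3) unfolding H(6) by blast
  then show False using v(2) assms(4) H(4,5) by auto
qed

subsection \<open>Brambles bound the treewidth from below\<close>

text \<open>The library defines connectedness by reachability in the symmetric closure; a predicate
  that agrees along arcs agrees along such walks.\<close>

lemma linked_if_connected:
  assumes "Digraph_Component.connected (with_proj T \<restriction> S)"
  shows "linked (parcs T) S" "S \<noteq> {}"
proof -
  let ?H = "with_proj (mk_symmetric (with_proj T \<restriction> S))"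
  have sc: "strongly_connected ?H"
    using assms by (simp add: Digraph_Component.connected_def)
  have V: "verts ?H = S" by (simp add: mk_symmetric_def)
  show "S \<noteq> {}" using sc V by (auto simp: strongly_connected_def)
  show "linked (parcs T) S"
  proof (rule linkedI)
    fix P :: "_ \<Rightarrow> bool" and x y
    assume P: "\<And>x y. x \<in> S \<Longrightarrow> y \<in> S \<Longrightarrow> (x, y) \<in> parcs T \<Longrightarrow> P x = P y"
      and "x \<in> S" "y \<in> S"
    then have "x \<rightarrow>\<^sup>*\<^bsub>?H\<^esub> y" using sc V by (auto simp: strongly_connected_def)
    then show "(P x :: bool) = P y"
      unfolding reachable_def
    proof (induction rule: rtrancl_on_induct)
      case (step y z)
      from step(2) have "y \<in> S" "z \<in> S" "(y, z) \<in> parcs T \<or> (z, y) \<in> parcs T"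
        by (auto simp: mk_symmetric_def induce_subgraph_def)
      then show ?case using step P by blast
    qed simp
  qed
qed

lemma connected_singleton:
  "Digraph_Component.connected (with_proj \<lparr>pverts = {x}, parcs = {}\<rparr> \<restriction> {x})"
  by (auto simp: Digraph_Component.connected_def strongly_connected_def mk_symmetric_def
    induce_subgraph_def reachable_def)

text \<open>The Helly property of subtrees. Remove a vertex \<open>v\<close> with at most one
  neighbour. If some \<open>F i\<close> is \<open>{v}\<close>, every set contains \<open>v\<close>.
  Otherwise each \<open>F i\<close> through \<open>v\<close> also contains the neighbour of
  \<open>v\<close>, so connectedness and pairwise intersection survive the removal.\<close>

lemma helly_linked:
  assumes "finite N" "sym E" "irrefl E" "degenerate 1 E N"
    and "\<And>i. i \<in> I \<Longrightarrow> F i \<subseteq> N \<and> linked E (F i)"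
    and "\<And>i j. i \<in> I \<Longrightarrow> j \<in> I \<Longrightarrow> F i \<inter> F j \<noteq> {}"
    and "I \<noteq> {}"
  shows "\<exists>x. \<forall>i\<in>I. x \<in> F i"
  using assms(1,4-6)
proof (induction N arbitrary: F rule: finite_psubset_induct)
  case (psubset N)
  from \<open>I \<noteq> {}\<close> obtain i0 where "i0 \<in> I" by auto
  then have "N \<noteq> {}" using psubset.prems(2,3) by fastforce
  then obtain v where v: "v \<in> N" "card (E `` {v} \<inter> N) \<le> 1"
    using psubset.prems(1) unfolding degenerate_def by blast
  have uniq: "a = b" if "(v, a) \<in> E" "(v, b) \<in> E" "a \<in> N" "b \<in> N" for a b
    using v(2) that psubset.hyps card_le_Suc0_iff_eq[of "E `` {v} \<inter> N"] by auto
  have sym: "(b, a) \<in> E" if "(a, b) \<in> E" for a b using \<open>sym E\<close> that by (auto dest: symD)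
  have nbr: "\<exists>u\<in>F i. (v, u) \<in> E" if F: "i \<in> I" "v \<in> F i" "F i \<noteq> {v}" for i
  proof -
    obtain y where "y \<in> F i" "y \<noteq> v" using F by blast
    with F psubset.prems(2) obtain u where "u \<in> F i" "(v, u) \<in> E \<or> (u, v) \<in> E"
      using linked_neighbour[of E "F i" v y] by metis
    then show ?thesis using sym by blast
  qed
  show ?case
  proof (cases "\<exists>i\<in>I. F i = {v}")
    case True
    then show ?thesis using psubset.prems(3) by fastforce
  next
    case False
    let ?F = "\<lambda>i. F i - {v}"
    have "\<exists>x. \<forall>i\<in>I. x \<in> ?F i"
    proof (rule psubset.IH[of "N - {v}"])
      show "N - {v} \<subset> N" using v by auto
      show "degenerate 1 E (N - {v})" using psubset.prems(1) unfolding degenerate_def by blast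
    next
      fix i assume i: "i \<in> I"
      have "linked E (?F i)"
      proof (rule linkedI)
        fix P :: "_ \<Rightarrow> bool" and x y
        assume P: "\<And>x y. x \<in> ?F i \<Longrightarrow> y \<in> ?F i \<Longrightarrow> (x, y) \<in> E \<Longrightarrow> P x = P y"
          and xy: "x \<in> ?F i" "y \<in> ?F i"
        have "\<exists>u. v \<in> F i \<longrightarrow> u \<in> F i \<and> (v, u) \<in> E"
          using nbr[OF i] False i by blast
        then obtain u where u: "v \<in> F i \<Longrightarrow> u \<in> F i \<and> (v, u) \<in> E" by blast
        \<comment> \<open>\<open>v\<close> inherits the value of its only neighbour
          \<open>u\<close>, which extends \<open>P\<close> to \<open>F i\<close> and keeps agreement
          along edges.\<close>
        define P' where "P' = P(v := P u)"
        have "P' x = P' y"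
        proof (rule linkedD[of E "F i" P'])
          show "linked E (F i)" using psubset.prems(2) i by blast
          fix a b assume ab: "a \<in> F i" "b \<in> F i" "(a, b) \<in> E"
          have "a \<noteq> b" using ab(3) \<open>irrefl E\<close> by (auto simp: irrefl_def)
          have sub: "F i \<subseteq> N" using psubset.prems(2) i by blast
          consider "a = v" | "b = v" | "a \<noteq> v" "b \<noteq> v" by auto
          then show "P' a = P' b"
          proof cases
            case 1
            then have "b = u" using u uniq[of b u] ab sub by blast
            then show ?thesis using 1 \<open>a \<noteq> b\<close> by (simp add: P'_def)
          next
            case 2
            then have "a = u" using u uniq[of a u] ab sub sym[of a b] by blast
            then show ?thesis using 2 \<open>a \<noteq> b\<close> by (simp add: P'_def)
          next
            case 3
            then show ?thesis using P ab by (simp add: P'_def)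
          qed
        qed (use xy in auto)
        then show "(P x :: bool) = P y" using xy by (simp add: P'_def)
      qed
      then show "?F i \<subseteq> N - {v} \<and> linked E (?F i)" using psubset.prems(2) i by blast
    next
      fix i j assume ij: "i \<in> I" "j \<in> I"
      obtain x where x: "x \<in> F i" "x \<in> F j" using psubset.prems(3) ij by blast
      show "?F i \<inter> ?F j \<noteq> {}"
      proof (cases "x = v")
        case True
        obtain a where a: "a \<in> F i" "(v, a) \<in> E" using nbr[of i] ij x True False by blast
        obtain b where b: "b \<in> F j" "(v, b) \<in> E" using nbr[of j] ij x True False by blast
        have "a = b" using uniq[of a b] a b psubset.prems(2)[of i] psubset.prems(2)[of j] ij by blast
        moreover have "a \<noteq> v" using a \<open>irrefl E\<close> by (auto simp: irrefl_def)
        ultimately show ?thesis using a b by blast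
      qed (use x in auto)
    qed
    then show ?thesis by blast
  qed
qed

lemma other_element_if_card_gt_1:
  assumes "\<not> (finite A \<and> card A \<le> 1)"
  obtains y where "y \<in> A" "y \<noteq> x"
proof -
  have "A \<noteq> {}" "A \<noteq> {x}" using assms by auto
  then show ?thesis using that by blast
qed

text \<open>Translates vertex lists into arc walks, so that a path built as a list can be closed to
  a library \<open>cycle\<close>.\<close>

lemma awalk_vwalk_arcs:
  assumes "pair_wf_digraph G" "xs \<noteq> []" "set xs \<subseteq> pverts G" "set (vwalk_arcs xs) \<subseteq> parcs G"
  shows "pre_digraph.awalk (with_proj G) (hd xs) (vwalk_arcs xs) (last xs)
    \<and> pre_digraph.awalk_verts (with_proj G) (hd xs) (vwalk_arcs xs) = xs"
proof -
  interpret pair_wf_digraph G by fact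
  show ?thesis using assms(2-)
  proof (induction xs rule: vwalk_arcs.induct)
    case (3 x y zs)
    then show ?case by (auto simp: awalk_Cons_iff awalk_verts.simps)
  qed (auto simp: awalk_Nil_iff awalk_verts.simps)
qed

lemma set_vwalk_arcs_take:
  "set (vwalk_arcs (take n xs)) \<subseteq> set (vwalk_arcs xs)"
  by (metis append_take_drop_id set_vwalk_arcs_append1)

text \<open>If every vertex of \<open>S\<close> had two neighbours in \<open>S\<close>, the first
  vertex of a longest path would have a neighbour other than its successor. By maximality that
  neighbour is on the path, which closes a cycle.\<close>

lemma acyclic_imp_degenerate:
  assumes G: "pair_graph G" and acyc: "\<not> (\<exists>p. pre_digraph.cycle (with_proj G) p \<and> length p \<ge> 3)"
  shows "degenerate 1 (parcs G) (pverts G)"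
  unfolding degenerate_def
proof (intro allI impI, rule ccontr)
  interpret pair_graph G by fact
  fix S assume S: "S \<subseteq> pverts G" "S \<noteq> {}"
    and neg: "\<not> (\<exists>v\<in>S. finite (parcs G `` {v} \<inter> S) \<and> card (parcs G `` {v} \<inter> S) \<le> 1)"
  have fin: "finite S" using S(1) by (rule finite_subset) simp
  define path where "path xs \<longleftrightarrow> xs \<noteq> [] \<and> distinct xs \<and> set xs \<subseteq> S \<and> set (vwalk_arcs xs) \<subseteq> parcs G" for xs
  obtain s where "s \<in> S" using S by auto
  then have "path [s]" by (simp add: path_def)
  moreover have "length xs < Suc (card S)" if "path xs" for xs
    using that fin by (metis card_mono distinct_card less_Suc_eq_le path_def)
  ultimately obtain xs where xs: "path xs" and max: "\<And>ys. path ys \<Longrightarrow> length ys \<le> length xs"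
    using ex_has_greatest_nat[of path "[s]" length "Suc (card S)"] by (metis less_imp_le)
  obtain x ys where xs_eq: "xs = x # ys" using xs by (cases xs) (auto simp: path_def)
  have "x \<in> S" using xs xs_eq by (simp add: path_def)
  then have "\<not> (finite (parcs G `` {x} \<inter> S) \<and> card (parcs G `` {x} \<inter> S) \<le> 1)"
    using neg by blast
  \<comment> \<open>\<open>hd ys\<close> is the successor of \<open>x\<close>; avoiding it gives
    \<open>n \<noteq> 0\<close> and thus a cycle of length at least 3. For empty \<open>ys\<close>
    it is an arbitrary value, but then \<open>y\<close> on the path and \<open>y \<noteq> x\<close>
    already clash.\<close>
  then obtain y where "y \<in> parcs G `` {x} \<inter> S" "y \<noteq> hd ys"
    using other_element_if_card_gt_1[of _ "hd ys"] by blast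
  then have y: "y \<in> S" "(x, y) \<in> parcs G" "y \<noteq> hd ys" by auto
  have yx: "(y, x) \<in> parcs G" using y arcs_symmetric by blast
  have "y \<in> set xs"
  proof (rule ccontr)
    assume "y \<notin> set xs"
    then have "path (y # xs)" using xs y yx xs_eq by (auto simp: path_def)
    then show False using max by fastforce
  qed
  moreover have "y \<noteq> x" using y no_loops[of "(x, y)"] by auto
  ultimately obtain n where n: "n < length ys" "ys ! n = y"
    unfolding xs_eq by (auto simp: in_set_conv_nth)
  have "n \<noteq> 0" using n y(3) by (metis hd_conv_nth length_0_conv less_zeroE)
  define zs where "zs = take (n + 2) xs"
  have zs: "zs = x # take (Suc n) ys" by (simp add: zs_def xs_eq)
  have last: "last zs = y" using n by (simp add: zs take_Suc_conv_app_nth)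
  have len: "length zs \<ge> 3" using n \<open>n \<noteq> 0\<close> by (simp add: zs)
  have dz: "distinct zs" using xs by (simp add: zs_def path_def)
  have sub: "set zs \<subseteq> pverts G" "set (vwalk_arcs zs) \<subseteq> parcs G"
    using xs S set_vwalk_arcs_take[of "n + 2" xs] set_take_subset[of "n + 2" xs]
    unfolding path_def zs_def by blast+
  let ?p = "vwalk_arcs (zs @ [x])"
  have "set ?p \<subseteq> parcs G"
    using sub yx last zs set_vwalk_arcs_snoc[of zs x] by auto
  then have aw: "awalk x ?p x" "awalk_verts x ?p = zs @ [x]"
    using awalk_vwalk_arcs[of G "zs @ [x]"] sub pair_wf_digraph zs by auto
  have "distinct (tl (zs @ [x]))" using dz zs by auto
  moreover have "length ?p = length zs"
    by (metis vwalk_length_def vwalk_length_simp length_append_singleton diff_Suc_1)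
  moreover have "?p \<noteq> []" using len calculation by auto
  ultimately have "cycle ?p" "length ?p \<ge> 3" using aw len unfolding cycle_def by auto
  then show False using acyc by blast
qed

text \<open>The nodes whose bags meet \<open>X i\<close> form a connected set, and two such sets
  share a node because a bag contains the edge joining the corresponding \<open>X i\<close> and
  \<open>X j\<close>. The Helly property then yields a common node.\<close>

lemma tree_decomposition_meets_bramble:
  assumes td: "tree_decomposition G T B"
    and X: "\<And>i. i \<in> I \<Longrightarrow> X i \<subseteq> pverts G \<and> X i \<noteq> {} \<and> linked (parcs G) (X i)"
    and touch: "\<And>i j. i \<in> I \<Longrightarrow> j \<in> I \<Longrightarrow> i \<noteq> j \<Longrightarrow> \<exists>u\<in>X i. \<exists>v\<in>X j. (u, v) \<in> parcs G \<or> (v, u) \<in> parcs G"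
    and "I \<noteq> {}"
  shows "\<exists>x\<in>pverts T. \<forall>i\<in>I. B x \<inter> X i \<noteq> {}"
proof -
  have T: "pair_graph T" "degenerate 1 (parcs T) (pverts T)"
    using td acyclic_imp_degenerate by (auto simp: tree_decomposition_def undirected_tree_def)
  interpret T: pair_graph T by fact
  let ?sub = "\<lambda>v. {x \<in> pverts T. v \<in> B x}"
  have edge: "\<exists>x\<in>pverts T. u \<in> B x \<and> v \<in> B x" if "(u, v) \<in> parcs G" for u v
    using td that by (auto simp: tree_decomposition_def)
  have sub: "linked (parcs T) (?sub v)" "?sub v \<noteq> {}" if "v \<in> pverts G" for v
    using td that linked_if_connected[of T "?sub v"] by (auto simp: tree_decomposition_def)
  let ?F = "\<lambda>i. {x \<in> pverts T. B x \<inter> X i \<noteq> {}}"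
  have "\<exists>x. \<forall>i\<in>I. x \<in> ?F i"
  proof (rule helly_linked[of "pverts T" "parcs T"])
    show "sym (parcs T)" using T.arcs_symmetric by (auto intro: symI)
    show "irrefl (parcs T)" using T.no_loops[of "(_, _)"] by (force simp: irrefl_def)
  next
    fix i assume i: "i \<in> I"
    have "linked (parcs T) (?F i)"
    proof (rule linkedI)
      fix P :: "_ \<Rightarrow> bool" and x y
      assume P: "\<And>x y. x \<in> ?F i \<Longrightarrow> y \<in> ?F i \<Longrightarrow> (x, y) \<in> parcs T \<Longrightarrow> P x = P y"
        and xy: "x \<in> ?F i" "y \<in> ?F i"
      \<comment> \<open>\<open>c v\<close> is the common value of \<open>P\<close> on all nodes
        whose bag contains \<open>v\<close>; the chosen node is immaterial, as these nodes are
        connected.\<close>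
      define c where "c v \<longleftrightarrow> P (SOME x. x \<in> ?sub v)" for v
      have c: "P x = c v" if "v \<in> X i" "x \<in> ?sub v" for v x
      proof -
        have "v \<in> pverts G" using X i that by blast
        note s = sub[OF this]
        have some: "(SOME x. x \<in> ?sub v) \<in> ?sub v" using s(2) by (rule some_in_eq[THEN iffD2])
        show ?thesis unfolding c_def
        proof (rule linkedD[OF s(1) _ that(2) some])
          fix a b assume "a \<in> ?sub v" "b \<in> ?sub v" "(a, b) \<in> parcs T"
          then show "P a = P b" using that(1) by (intro P) auto
        qed
      qed
      have cc: "c u = c v" if "u \<in> X i" "v \<in> X i" for u v
      proof (rule linkedD[of "parcs G" "X i" c])
        fix a b assume ab: "a \<in> X i" "b \<in> X i" "(a, b) \<in> parcs G"
        then obtain z where "z \<in> ?sub a" "z \<in> ?sub b" using edge by blast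
        then show "c a = c b" using c ab by blast
      qed (use X i that in auto)
      obtain u v where "u \<in> X i" "x \<in> ?sub u" "v \<in> X i" "y \<in> ?sub v" using xy by blast
      then show "(P x :: bool) = P y" using c cc by metis
    qed
    then show "?F i \<subseteq> pverts T \<and> linked (parcs T) (?F i)" by auto
  next
    fix i j assume ij: "i \<in> I" "j \<in> I"
    show "?F i \<inter> ?F j \<noteq> {}"
    proof (cases "i = j")
      case True
      obtain v where "v \<in> X i" "v \<in> pverts G" using X ij by blast
      then show ?thesis using sub(2)[of v] True by blast
    next
      case False
      then obtain u v where "u \<in> X i" "v \<in> X j" "(u, v) \<in> parcs G \<or> (v, u) \<in> parcs G"
        using touch ij by blast
      moreover from this obtain x where "x \<in> pverts T" "u \<in> B x" "v \<in> B x" using edge by blast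
      ultimately show ?thesis by blast
    qed
  qed (use T \<open>I \<noteq> {}\<close> in auto)
  then show ?thesis using \<open>I \<noteq> {}\<close> by blast
qed

text \<open>The \<open>LEAST\<close> in \<open>treewidth\<close> is meaningful only if some
  decomposition exists; a single bag with all vertices is one.\<close>

lemma treewidth_witness:
  assumes "pair_graph G"
  obtains T :: "nat pair_pre_digraph" and B
  where "tree_decomposition G T B" "decomposition_width T B = treewidth G"
proof -
  interpret pair_graph G by fact
  let ?T = "\<lparr>pverts = {0 :: nat}, parcs = {}\<rparr>"
  have T: "pair_graph ?T" by unfold_locales (auto simp: symmetric_def sym_def)
  then interpret T: pair_graph ?T .
  have "\<not> T.cycle p" for p
    by (cases p) (auto simp: T.cycle_def T.awalk_Cons_iff)
  then have "undirected_tree ?T"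
    unfolding undirected_tree_def using T connected_singleton[of "0 :: nat"]
    by (auto simp: induce_subgraph_def with_proj_def)
  then have "tree_decomposition G ?T (\<lambda>_. pverts G)"
    using connected_singleton[of "0 :: nat"] by (auto simp: tree_decomposition_def dest: wellformed)
  then have "\<exists>w. \<exists>(T :: nat pair_pre_digraph) B. tree_decomposition G T B \<and> decomposition_width T B = w"
    by blast
  from LeastI_ex[OF this] show ?thesis using that unfolding treewidth_def by blast
qed

text \<open>A bag meeting \<open>k + 1\<close> disjoint sets has at least \<open>k + 1\<close>
  vertices; indices from 0 to \<open>k\<close> absorb the \<open>- 1\<close> in the width.\<close>

lemma treewidth_ge_bramble:
  fixes X :: "nat \<Rightarrow> 'a set"
  assumes G: "pair_graph G"
    and X: "\<And>i. i \<le> k \<Longrightarrow> X i \<subseteq> pverts G \<and> X i \<noteq> {} \<and> linked (parcs G) (X i)"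
    and touch: "\<And>i j. i \<le> k \<Longrightarrow> j \<le> k \<Longrightarrow> i \<noteq> j \<Longrightarrow> \<exists>u\<in>X i. \<exists>v\<in>X j. (u, v) \<in> parcs G \<or> (v, u) \<in> parcs G"
    and disj: "\<And>i j. i \<le> k \<Longrightarrow> j \<le> k \<Longrightarrow> i \<noteq> j \<Longrightarrow> X i \<inter> X j = {}"
  shows "k \<le> treewidth G"
proof -
  interpret pair_graph G by fact
  obtain T :: "nat pair_pre_digraph" and B
    where td: "tree_decomposition G T B" and w: "decomposition_width T B = treewidth G"
    using treewidth_witness[OF G] by blast
  have finT: "finite (pverts T)" using td
    by (auto simp: tree_decomposition_def undirected_tree_def pair_graph_def pair_digraph_def pair_fin_digraph_def pair_fin_digraph_axioms_def)
  obtain x where x: "x \<in> pverts T" "\<And>i. i \<le> k \<Longrightarrow> B x \<inter> X i \<noteq> {}"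
    using tree_decomposition_meets_bramble[OF td, of "{..k}" X] X touch by auto
  define g where "g i = (SOME v. v \<in> B x \<inter> X i)" for i
  have g: "g i \<in> B x" "g i \<in> X i" if "i \<le> k" for i
    using x(2)[OF that] some_in_eq[of "B x \<inter> X i"] unfolding g_def by auto
  have "inj_on g {..k}" using g disj by (intro inj_onI) (metis atMost_iff disjoint_iff)
  moreover have "finite (B x)"
    using td x(1) finite_subset[of "B x" "pverts G"] by (auto simp: tree_decomposition_def)
  ultimately have "Suc k \<le> card (B x)" using card_inj_on_le[of g "{..k}" "B x"] g by auto
  also have "\<dots> \<le> Max ((\<lambda>x. card (B x)) ` pverts T)" using finT x by auto
  finally show ?thesis using w by (simp add: decomposition_width_def)
qed

subsection \<open>Chord diagrams and an obstruction\<close>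

text \<open>
  The circle is cut open, so that endpoints of chords are natural numbers; a chord \<open>u\<close> has the endpoints
  \<open>l u\<close> and \<open>h u\<close>, in either order. Two chords cross iff an odd number of the four comparisons between
  their endpoints hold, which makes invariance under moving the cut a parity argument.
\<close>

definition separated :: "nat \<Rightarrow> nat \<Rightarrow> nat \<Rightarrow> bool" where
  "separated a b x \<longleftrightarrow> (a < x) \<noteq> (b < x)"

definition interlaced :: "('a \<Rightarrow> nat) \<Rightarrow> ('a \<Rightarrow> nat) \<Rightarrow> 'a \<Rightarrow> 'a \<Rightarrow> bool" where
  "interlaced l h u v \<longleftrightarrow> separated (l u) (h u) (l v) \<noteq> separated (l u) (h u) (h v)"

definition chord_model :: "('a \<times> 'a) set \<Rightarrow> 'a set \<Rightarrow> ('a \<Rightarrow> nat) \<Rightarrow> ('a \<Rightarrow> nat) \<Rightarrow> bool" where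
  "chord_model E V l h \<longleftrightarrow>
     (\<forall>u\<in>V. l u \<noteq> h u) \<and>
     (\<forall>u\<in>V. \<forall>v\<in>V. u \<noteq> v \<longrightarrow> l u \<noteq> l v \<and> l u \<noteq> h v \<and> h u \<noteq> h v) \<and>
     (\<forall>u\<in>V. \<forall>v\<in>V. u \<noteq> v \<longrightarrow> ((u, v) \<in> E \<longleftrightarrow> interlaced l h u v))"

text \<open>A point \<open>c\<close> outside the interval between \<open>a\<close> and
  \<open>b\<close> has the whole interval, hence both \<open>a\<close> and \<open>x\<close>, on one
  side.\<close>

lemma separated_imp_less_iff:
  assumes "separated a b x" "\<not> separated a b c" "c \<notin> {a, b, x}"
  shows "c < x \<longleftrightarrow> c < a"
proof (cases "a < c")
  case True
  then have "b < c" using assms by (simp add: separated_def)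
  then show ?thesis using True assms by (cases "c < x") (auto simp: separated_def)
next
  case False
  then have "c < a" "c < b" using assms by (simp_all add: separated_def)
  then show ?thesis using assms by (cases "c < x") (auto simp: separated_def)
qed

text \<open>An interval whose ends avoid the one between \<open>a\<close> and \<open>b\<close>
  contains all or nothing of it, so it cannot tell \<open>x\<close> from \<open>a\<close>.\<close>

lemma separated_inside:
  assumes "separated a b x" "\<not> separated a b c" "\<not> separated a b d"
    and "distinct [a, b, c, d, x]"
  shows "separated c d x = separated c d a"
proof -
  have "c < x \<longleftrightarrow> c < a" "d < x \<longleftrightarrow> d < a"
    using assms separated_imp_less_iff[of a b x c] separated_imp_less_iff[of a b x d] by auto
  then show ?thesis by (simp add: separated_def)
qed

lemma separated_inside_outside:
  assumes "separated a b c" "separated a b d" "\<not> separated a b e" "e \<notin> {a, b, c, d}"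
  shows "\<not> separated c d e"
proof -
  have "e < c \<longleftrightarrow> e < a" "e < d \<longleftrightarrow> e < a"
    using assms separated_imp_less_iff[of a b c e] separated_imp_less_iff[of a b d e] by auto
  then show ?thesis using assms(4) by (auto simp: separated_def)
qed

text \<open>The ends \<open>a\<close>, \<open>b\<close> cut the circle into two arcs. A chord that
  does not cross this one keeps both ends in one arc, and chords from different arcs cannot
  cross.\<close>

lemma separated_if_interlaced:
  assumes "separated a b c = separated a b d" "separated a b e = separated a b f"
    and "separated c d e \<noteq> separated c d f"
    and "distinct [a, b, c, d, e, f]"
  shows "separated a b c = separated a b e"
proof (rule ccontr)
  assume neq: "separated a b c \<noteq> separated a b e"
  show False
  proof (cases "separated a b c")
    case True
    have "\<not> separated c d e" "\<not> separated c d f"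
      by (rule separated_inside_outside[of a b]; use True assms neq in auto)+
    then show ?thesis using assms(3) by simp
  next
    case False
    have "separated c d e = separated c d a" "separated c d f = separated c d a"
      by (rule separated_inside[of a b]; use False assms neq in auto)+
    then show ?thesis using assms(3) by simp
  qed
qed

text \<open>Crossing intervals overlap, so a point covered by neither cannot lie between
  them.\<close>

lemma same_side_if_interlaced:
  assumes "\<not> separated a b x" "\<not> separated c d x" "separated a b c \<noteq> separated a b d"
    and "distinct [a, b, c, d, x]"
  shows "(a < x) = (c < x)"
proof (rule ccontr)
  assume neq: "(a < x) \<noteq> (c < x)"
  have "(a < x) = (b < x)" "(c < x) = (d < x)" using assms by (simp_all add: separated_def)
  then have "a < c \<and> b < c \<and> a < d \<and> b < d \<or> c < a \<and> c < b \<and> d < a \<and> d < b"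
    using neq assms(4) by (cases "a < x") auto
  then show False using assms(3) by (auto simp: separated_def)
qed
text \<open>Swapping the roles negates all four comparisons, which keeps the parity.\<close>

lemma interlaced_sym:
  assumes "l u \<noteq> l v" "l u \<noteq> h v" "h u \<noteq> l v" "h u \<noteq> h v"
  shows "interlaced l h u v = interlaced l h v u"
proof -
  have "l v < l u \<longleftrightarrow> \<not> l u < l v" "h v < l u \<longleftrightarrow> \<not> l u < h v" "l v < h u \<longleftrightarrow> \<not> h u < l v"
    "h v < h u \<longleftrightarrow> \<not> h u < h v"
    using assms by auto
  then show ?thesis unfolding interlaced_def separated_def by auto
qed

lemma chord_model_rotate:
  assumes model: "chord_model E V l h" and "finite V" "q \<in> V"
  obtains l' h' where "chord_model E V l' h'"
    "\<And>v. v \<in> V \<Longrightarrow> v \<noteq> q \<Longrightarrow> l' q < l' v \<and> l' q < h' v" "l' q < h' q"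
proof -
  define N where "N = Suc (Max (l ` V \<union> h ` V))"
  have N: "l v < N" "h v < N" if "v \<in> V" for v
    using that \<open>finite V\<close> by (auto simp: N_def less_Suc_eq_le)
  define y where "y = l q"
  \<comment> \<open>Positions before \<open>l q\<close> move past the end. A comparison flips iff
    exactly one of its positions lies before \<open>y\<close>; each position occurs in two of the
    four comparisons of \<open>interlaced\<close>, so the flips cancel.\<close>
  define r where "r x = (if x < y then x + N else x)" for x
  have r: "r a < r x \<longleftrightarrow> ((a < x) \<noteq> ((a < y) \<noteq> (x < y)))" if "a < N" "x < N" for a x
    using that by (auto simp: r_def)
  have eq: "r a = r x \<longleftrightarrow> a = x" if "a < N" "x < N" for a x
    using that by (auto simp: r_def)
  have "interlaced (r \<circ> l) (r \<circ> h) u v = interlaced l h u v" if "u \<in> V" "v \<in> V" for u v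
    using that by (simp add: interlaced_def separated_def r N) blast
  then have "chord_model E V (r \<circ> l) (r \<circ> h)"
    using model unfolding chord_model_def by (simp add: eq N)
  moreover have "(r \<circ> l) q < (r \<circ> l) v \<and> (r \<circ> l) q < (r \<circ> h) v" if "v \<in> V" "v \<noteq> q" for v
  proof -
    have "l q \<noteq> l v" "l q \<noteq> h v" using model that \<open>q \<in> V\<close> by (auto simp: chord_model_def)
    then show ?thesis using N[OF that(1)] N[OF \<open>q \<in> V\<close>] by (auto simp: r_def y_def)
  qed
  moreover have "(r \<circ> l) q < (r \<circ> h) q"
    using model N[OF \<open>q \<in> V\<close>] \<open>q \<in> V\<close> by (auto simp: r_def y_def chord_model_def)
  ultimately show ?thesis using that by blast
qed

text \<open>The last clause makes the ends of the members of \<open>M\<close> distinct and supplies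
  the chords of \<open>P\<close> on both sides of the middle end.\<close>

definition obstruction :: "('a \<times> 'a) set \<Rightarrow> 'a set \<Rightarrow> 'a set \<Rightarrow> 'a set \<Rightarrow> bool" where
  "obstruction E P M Q \<longleftrightarrow>
     P \<inter> Q = {} \<and> M \<inter> P = {} \<and> M \<inter> Q = {} \<and> linked E P \<and> linked E Q \<and> Q \<noteq> {} \<and>
     (\<forall>p\<in>P. \<forall>q\<in>Q. (p, q) \<notin> E) \<and>
     3 \<le> card M \<and> (\<forall>m\<in>M. \<exists>q\<in>Q. (m, q) \<in> E) \<and>
     (\<forall>m\<in>M. linked E {p \<in> P. (m, p) \<notin> E}) \<and>
     (\<forall>m\<in>M. \<forall>m'\<in>M. m \<noteq> m' \<longrightarrow> (\<exists>p\<in>P. (m', p) \<in> E \<and> (m, p) \<notin> E))"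

lemma three_increasing:
  fixes A :: "nat set"
  assumes "3 \<le> card A"
  obtains a b c where "a \<in> A" "b \<in> A" "c \<in> A" "a < b" "b < c"
proof -
  have fin: "finite A" "A \<noteq> {}" using assms by (auto intro: card_ge_0_finite)
  have "card {Min A, Max A} \<le> 2" by (simp add: card_insert_if)
  then have "\<not> A \<subseteq> {Min A, Max A}" using assms card_mono[of "{Min A, Max A}" A] by auto
  then obtain b where b: "b \<in> A" "b \<noteq> Min A" "b \<noteq> Max A" by auto
  then have "Min A < b" "b < Max A" using fin by (simp_all add: order_less_le)
  then show ?thesis using that b fin by (meson Max_in Min_in)
qed

lemma chord_model_no_obstruction:
  assumes "chord_model E V l h" "finite V" "P \<subseteq> V" "M \<subseteq> V" "Q \<subseteq> V" "obstruction E P M Q"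
  shows False
proof -
  have disj: "P \<inter> Q = {}" "M \<inter> P = {}" "M \<inter> Q = {}" and "linked E P" "linked E Q" "Q \<noteq> {}" "3 \<le> card M"
    and anti: "\<And>p q. p \<in> P \<Longrightarrow> q \<in> Q \<Longrightarrow> (p, q) \<notin> E"
    and MQ: "\<And>m. m \<in> M \<Longrightarrow> \<exists>q\<in>Q. (m, q) \<in> E"
    and rest: "\<And>m. m \<in> M \<Longrightarrow> linked E {p \<in> P. (m, p) \<notin> E}"
    and diff: "\<And>m m'. m \<in> M \<Longrightarrow> m' \<in> M \<Longrightarrow> m \<noteq> m' \<Longrightarrow> \<exists>p\<in>P. (m', p) \<in> E \<and> (m, p) \<notin> E"
    using assms(6) unfolding obstruction_def by auto
  \<comment> \<open>Cut the circle at an endpoint of \<open>Q\<close>; then no chord of \<open>P\<close> encloses an endpoint of \<open>Q\<close>.\<close>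
  obtain q0 where q0: "q0 \<in> Q" using \<open>Q \<noteq> {}\<close> by auto
  then obtain l h where model: "chord_model E V l h"
    and min: "\<And>v. v \<in> V \<Longrightarrow> v \<noteq> q0 \<Longrightarrow> l q0 < l v \<and> l q0 < h v"
    using chord_model_rotate[OF assms(1,2)] assms(5) by (metis subsetD)
  have loop: "l u \<noteq> h u" if "u \<in> V" for u using model that by (auto simp: chord_model_def)
  have dist: "l u \<noteq> l v" "l u \<noteq> h v" "h u \<noteq> l v" "h u \<noteq> h v" if "u \<in> V" "v \<in> V" "u \<noteq> v" for u v
    using model that unfolding chord_model_def by metis+
  have adj: "(u, v) \<in> E \<longleftrightarrow> interlaced l h u v" if "u \<in> V" "v \<in> V" "u \<noteq> v" for u v
    using model that unfolding chord_model_def by blast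
  have adj': "(u, v) \<in> E \<longleftrightarrow> interlaced l h v u" if "u \<in> V" "v \<in> V" "u \<noteq> v" for u v
    using adj[OF that] interlaced_sym dist[OF that] by metis
  let ?cov = "\<lambda>u x. separated (l u) (h u) x"
  \<comment> \<open>A connected set of chords, none of which crosses \<open>u\<close>, lies in one
    of the two arcs cut off by \<open>u\<close>.\<close>
  have side: "?cov u (l v) = ?cov u (l w)"
    if "linked E S" "u \<in> V" "S \<subseteq> V" "u \<notin> S" "v \<in> S" "w \<in> S" "\<And>s. s \<in> S \<Longrightarrow> \<not> interlaced l h u s" for S u v w
  proof (rule linkedD[OF that(1) _ that(5,6)])
    fix a b assume ab: "a \<in> S" "b \<in> S" "(a, b) \<in> E"
    show "?cov u (l a) = ?cov u (l b)"
    proof (cases "a = b")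
      case False
      have "a \<in> V" "b \<in> V" "u \<noteq> a" "u \<noteq> b" using ab that by auto
      then show ?thesis
        using separated_if_interlaced[of "l u" "h u" "l a" "h a" "l b" "h b"] that(7)[OF ab(1)] that(7)[OF ab(2)]
          adj[of a b] ab(3) False loop dist \<open>u \<in> V\<close>
        unfolding interlaced_def by simp
    qed simp
  qed
  have uncov: "\<not> ?cov p (l q) \<and> \<not> ?cov p (h q)" if "p \<in> P" "q \<in> Q" for p q
  proof -
    have pV: "p \<in> V" "p \<notin> Q" using that assms(3) disj by auto
    have non: "\<not> interlaced l h p s" if "s \<in> Q" for s
      using anti[OF \<open>p \<in> P\<close> that] adj[of p s] pV that assms(5) by blast
    have "?cov p (l q) = ?cov p (l q0)"
      using side[OF \<open>linked E Q\<close> pV(1) assms(5) pV(2) that(2) q0] non by blast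
    moreover have "p \<noteq> q0" using pV q0 by blast
    then have "\<not> ?cov p (l q0)" using min[of p] pV by (auto simp: separated_def)
    ultimately show ?thesis using non[OF that(2)] by (simp add: interlaced_def)
  qed
  have Pside: "?cov q (l p) = ?cov q (l p')" if "p \<in> P" "p' \<in> P" "q \<in> Q" for p p' q
  proof -
    have qV: "q \<in> V" "q \<notin> P" using that assms(5) disj by auto
    have "\<not> interlaced l h q s" if "s \<in> P" for s
      using anti[OF that \<open>q \<in> Q\<close>] adj'[of s q] qV that assms(3) by blast
    then show ?thesis using side[OF \<open>linked E P\<close> qV(1) assms(3) qV(2) that(1,2)] by blast
  qed
  \<comment> \<open>Otherwise both ends of \<open>m\<close> lie in the arc of \<open>P\<close>. No
    chord of \<open>Q\<close> splits that arc, so none could cross \<open>m\<close>.\<close>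
  have one: "\<not> (?cov p (l m) \<and> ?cov p' (h m))" if "m \<in> M" "p \<in> P" "p' \<in> P" for m p p'
  proof
    assume c: "?cov p (l m) \<and> ?cov p' (h m)"
    obtain q where q: "q \<in> Q" "(m, q) \<in> E" using MQ \<open>m \<in> M\<close> by blast
    have V: "p \<in> V" "p' \<in> V" "q \<in> V" "m \<in> V" "m \<noteq> q" "m \<noteq> p" "m \<noteq> p'" "p \<noteq> q" "p' \<noteq> q"
      using that q disj assms(3-5) by auto
    have "?cov q (l m) = ?cov q (l p)"
      using separated_inside[of "l p" "h p" "l m" "l q" "h q"] c uncov[OF that(2) q(1)] V loop dist by auto
    also have "\<dots> = ?cov q (l p')" using Pside that q by blast
    also have "\<dots> = ?cov q (h m)"
      using separated_inside[of "l p'" "h p'" "h m" "l q" "h q"] c uncov[OF that(3) q(1)] V loop dist by auto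
    finally show False using adj'[of m q] q V by (simp add: interlaced_def)
  qed
  \<comment> \<open>The end of \<open>m\<close> in the arc of \<open>P\<close>. The default
    \<open>h m\<close> is harmless: if no chord of \<open>P\<close> encloses either end,
    \<open>m\<close> has no neighbour in \<open>P\<close> and the equivalence below still
    holds.\<close>
  define x where "x m = (if \<exists>p\<in>P. ?cov p (l m) then l m else h m)" for m
  have x: "(m, p) \<in> E \<longleftrightarrow> ?cov p (x m)" if "m \<in> M" "p \<in> P" for m p
  proof -
    have "m \<in> V" "p \<in> V" "m \<noteq> p" using that disj assms(3,4) by auto
    then have "(m, p) \<in> E \<longleftrightarrow> ?cov p (l m) \<noteq> ?cov p (h m)" using adj' by (simp add: interlaced_def)
    then show ?thesis using one[OF that(1)] that(2) unfolding x_def by auto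
  qed
  have "inj_on x M" using diff x by (intro inj_onI) metis
  then have "3 \<le> card (x ` M)" using \<open>3 \<le> card M\<close> by (simp add: card_image)
  then obtain a b c where "a \<in> x ` M" "b \<in> x ` M" "c \<in> x ` M" "a < b" "b < c"
    using three_increasing by blast
  then obtain m1 m2 m3 where m: "m1 \<in> M" "m2 \<in> M" "m3 \<in> M" "x m1 < x m2" "x m2 < x m3" by blast
  let ?R = "{p \<in> P. (m2, p) \<notin> E}"
  \<comment> \<open>Chords in \<open>?R\<close> do not enclose \<open>x m2\<close>, and crossing
    ones lie on the same side of it; connectedness spreads this to all of \<open>?R\<close>.\<close>
  have sideR: "(l p < x m2) = (l p' < x m2)" if "p \<in> ?R" "p' \<in> ?R" for p p'
  proof (rule linkedD[OF rest[OF m(2)] _ that])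
    fix a b assume ab: "a \<in> ?R" "b \<in> ?R" "(a, b) \<in> E"
    show "(l a < x m2) = (l b < x m2)"
    proof (cases "a = b")
      case False
      have V: "a \<in> V" "b \<in> V" "m2 \<in> V" "m2 \<noteq> a" "m2 \<noteq> b" using ab m disj assms(3,4) by auto
      then have "distinct [l a, h a, l b, h b, x m2]" using False loop dist by (auto simp: x_def)
      then show ?thesis
        using same_side_if_interlaced[of "l a" "h a" "x m2" "l b" "h b"] ab x[OF m(2)]
          adj[of a b] False V by (auto simp: interlaced_def)
    qed simp
  qed
  \<comment> \<open>A chord enclosing \<open>x m1\<close> but not \<open>x m2\<close> lies to the
    left of \<open>x m2\<close>; likewise \<open>p3\<close> lies to the right.\<close>
  obtain p1 where p1: "p1 \<in> P" "(m1, p1) \<in> E" "(m2, p1) \<notin> E" using diff[of m2 m1] m by force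
  obtain p3 where p3: "p3 \<in> P" "(m3, p3) \<in> E" "(m2, p3) \<notin> E" using diff[of m2 m3] m by force
  have "l p1 < x m2"
    using x[OF m(1) p1(1)] x[OF m(2) p1(1)] p1 m(4) by (auto simp: separated_def)
  moreover have "\<not> l p3 < x m2"
    using x[OF m(3) p3(1)] x[OF m(2) p3(1)] p3 m(5) by (auto simp: separated_def)
  ultimately show False using sideR p1 p3 by blast
qed

lemma chord_model_induced:
  assumes "chord_model (parcs G) (pverts G) l h" "contains_induced G H"
  obtains l' h' where "chord_model (parcs H) (pverts H) l' h'"
proof -
  obtain H' where H': "pverts H' \<subseteq> pverts G" "parcs H' = parcs G \<inter> pverts H' \<times> pverts H'"
    and "digraph_iso (with_proj H) (with_proj H')"
    using assms(2) unfolding contains_induced_def induced_subgraph_pair_iff by blast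
  then obtain f where f: "pair_wf_digraph H" "inj_on f (pverts H)" "pverts H' = f ` pverts H"
    "parcs H' = map_prod f f ` parcs H"
    unfolding digraph_iso_pair_iff by blast
  have adj: "(u, v) \<in> parcs H \<longleftrightarrow> (f u, f v) \<in> parcs G" if "u \<in> pverts H" "v \<in> pverts H" for u v
  proof -
    have "(f u, f v) \<in> parcs G \<longleftrightarrow> (f u, f v) \<in> map_prod f f ` parcs H"
      using H' f that by auto
    also have "\<dots> \<longleftrightarrow> (u, v) \<in> parcs H"
    proof
      assume "(f u, f v) \<in> map_prod f f ` parcs H"
      then obtain a b where ab: "(a, b) \<in> parcs H" "f a = f u" "f b = f v" by auto
      then have "a \<in> pverts H" "b \<in> pverts H"
        using f(1) pair_wf_digraph.arc_fst_in_verts pair_wf_digraph.arc_snd_in_verts by fastforce+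
      then show "(u, v) \<in> parcs H" using ab f(2) that by (metis inj_onD)
    qed force
    finally show ?thesis ..
  qed
  have "f u \<in> pverts G" if "u \<in> pverts H" for u using that H' f by blast
  moreover have "f u \<noteq> f v" if "u \<in> pverts H" "v \<in> pverts H" "u \<noteq> v" for u v
    using f(2) that by (auto dest: inj_onD)
  ultimately have "chord_model (parcs H) (pverts H) (l \<circ> f) (h \<circ> f)"
    using assms(1) adj unfolding chord_model_def interlaced_def by simp
  then show ?thesis using that by blast
qed

subsection \<open>Subdivided walls and their line graphs\<close>

text \<open>
  What is kept of a wall under subdivision: \<open>P\<close> generalises a brick, \<open>Q\<close> is far from it, and \<open>M\<close> consists
  of vertices connecting the two. Subdividing an edge inside \<open>P\<close> turns the deletion of an edge into the
  deletion of a vertex, hence the two connectivity conditions on \<open>P\<close>.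
\<close>

locale frame =
  fixes E :: "('a \<times> 'a) set" and P M Q :: "'a set"
  assumes P_Int_Q: "P \<inter> Q = {}" and M_Int_P: "M \<inter> P = {}" and M_Int_Q: "M \<inter> Q = {}"
    and linked_P: "linked E P" and linked_Q: "linked E Q" and Q_nonempty: "Q \<noteq> {}"
    and linked_P_minus_vertex: "\<And>p. p \<in> P \<Longrightarrow> linked E (P - {p})"
    and linked_P_minus_edge:
      "\<And>a b. a \<in> P \<Longrightarrow> b \<in> P \<Longrightarrow> (a, b) \<in> E \<Longrightarrow> linked (E - {(a, b), (b, a)}) P"
    and P_third_vertex: "\<And>a b. \<exists>c\<in>P. c \<noteq> a \<and> c \<noteq> b"
    and no_edge_P_Q: "\<And>p q. p \<in> P \<Longrightarrow> q \<in> Q \<Longrightarrow> (p, q) \<notin> E"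
    and card_M: "3 \<le> card M"
    and M_edge_Q: "\<And>m. m \<in> M \<Longrightarrow> \<exists>q\<in>Q. (m, q) \<in> E"
    and M_unique_edge_P: "\<And>m. m \<in> M \<Longrightarrow> \<exists>!p. p \<in> P \<and> (m, p) \<in> E"
    and P_unique_edge_M:
      "\<And>p m m'. p \<in> P \<Longrightarrow> m \<in> M \<Longrightarrow> m' \<in> M \<Longrightarrow> (m, p) \<in> E \<Longrightarrow> (m', p) \<in> E \<Longrightarrow> m = m'"
begin

lemmas frame_facts = P_Int_Q M_Int_P M_Int_Q linked_P linked_Q Q_nonempty linked_P_minus_vertex
  linked_P_minus_edge P_third_vertex no_edge_P_Q card_M M_edge_Q M_unique_edge_P P_unique_edge_M

end

text \<open>A member of \<open>M\<close> has a single neighbour in \<open>P\<close>, so removing its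
  neighbourhood removes one vertex, and different members have different neighbours.\<close>

lemma frame_imp_obstruction:
  assumes "frame E P M Q"
  shows "obstruction E P M Q"
proof -
  note F = frame.frame_facts[OF assms]
  have "linked E {p \<in> P. (m, p) \<notin> E}" if m: "m \<in> M" for m
  proof -
    obtain p where p: "p \<in> P" "(m, p) \<in> E" "\<And>p'. p' \<in> P \<Longrightarrow> (m, p') \<in> E \<Longrightarrow> p' = p"
      using F(13)[OF m] by blast
    then have "{p \<in> P. (m, p) \<notin> E} = P - {p}" by blast
    then show ?thesis using F(7)[OF p(1)] by simp
  qed
  moreover have "\<exists>p\<in>P. (m', p) \<in> E \<and> (m, p) \<notin> E" if "m \<in> M" "m' \<in> M" "m \<noteq> m'" for m m'
    using F(13)[OF that(2)] F(14) that by blast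
  ultimately show ?thesis
    unfolding obstruction_def using F(1-6,11) F(10) F(12) by (intro conjI ballI impI) blast+
qed

section \<open>Invariance of frames under subdividing one edge\<close>

definition subdivided :: "('a \<times> 'a) set \<Rightarrow> 'a \<Rightarrow> 'a \<Rightarrow> 'a \<Rightarrow> ('a \<times> 'a) set" where
  "subdivided E u v w = E - {(u, v), (v, u)} \<union> {(u, w), (w, u), (w, v), (v, w)}"

lemma subdivided_commute: "subdivided E u v w = subdivided E v u w"
  by (auto simp: subdivided_def)

context
  fixes E :: "('a \<times> 'a) set" and V P M Q :: "'a set" and u v w :: 'a
  assumes sym: "sym E" and irrefl: "irrefl E" and E: "E \<subseteq> V \<times> V"
    and uv: "(u, v) \<in> E" and w: "w \<notin> V"
    and F: "frame E P M Q" and sub: "P \<subseteq> V" "M \<subseteq> V" "Q \<subseteq> V"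
begin

private abbreviation "E' \<equiv> subdivided E u v w"

private lemma facts: "u \<noteq> v" "u \<noteq> w" "v \<noteq> w" "u \<in> V" "v \<in> V" "(v, u) \<in> E" "(w, x) \<notin> E" "(x, w) \<notin> E"
  "w \<notin> P" "w \<notin> M" "w \<notin> Q"
  using uv sym irrefl w E sub by (auto simp: irrefl_def dest: symD)

private lemma iff:
  "x \<noteq> w \<Longrightarrow> y \<noteq> w \<Longrightarrow> (x, y) \<in> E' \<longleftrightarrow> (x, y) \<in> E \<and> (x, y) \<noteq> (u, v) \<and> (x, y) \<noteq> (v, u)"
  "x \<noteq> w \<Longrightarrow> (x, w) \<in> E' \<longleftrightarrow> x = u \<or> x = v"
  "x \<noteq> w \<Longrightarrow> (w, x) \<in> E' \<longleftrightarrow> x = u \<or> x = v"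
  using facts by (auto simp: subdivided_def)

private lemma linked_unchanged:
  assumes "linked E S" "\<not> (u \<in> S \<and> v \<in> S)" "S \<subseteq> V"
  shows "linked E' S"
  by (rule linked_mono[OF assms(1)]) (use assms w in \<open>auto simp: subdivided_def\<close>)

text \<open>\<open>w\<close> joins \<open>P\<close>. Deleting \<open>w\<close> amounts to deleting
  the edge \<open>uv\<close> from the old \<open>P\<close>; deleting one of the two edges at
  \<open>w\<close> leaves \<open>w\<close> hanging from that same set by the other edge.\<close>

private lemma frame_PP:
  assumes "u \<in> P" "v \<in> P"
  shows "frame E' (insert w P) M Q"
proof -
  note D = frame.frame_facts[OF F]
  have E0: "linked (E - {(u, v), (v, u)}) P" using D(8) assms uv by blast
  have "linked E' (insert w P - {p})" if "p \<in> insert w P" for p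
  proof -
    consider "p = w" | "p = u" | "p = v" | "p \<in> P" "p \<notin> {u, v, w}" using \<open>p \<in> insert w P\<close> by blast
    then show ?thesis
    proof cases
      case 1
      then have "insert w P - {p} = P" using facts by auto
      moreover have "linked E' P" by (rule linked_mono[OF E0]) (auto simp: subdivided_def)
      ultimately show ?thesis by simp
    next
      case 2
      then have "insert w P - {p} = insert w (P - {u})" using facts by auto
      moreover have "linked E' (P - {u})" using D(7)[OF assms(1)] sub by (intro linked_unchanged) auto
      ultimately show ?thesis using linked_insert[of E' "P - {u}" v w] assms facts by (auto simp: subdivided_def)
    next
      case 3
      then have "insert w P - {p} = insert w (P - {v})" using facts by auto
      moreover have "linked E' (P - {v})" using D(7)[OF assms(2)] sub by (intro linked_unchanged) auto
      ultimately show ?thesis using linked_insert[of E' "P - {v}" u w] assms facts by (auto simp: subdivided_def)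
    next
      case 4
      then have "insert w P - {p} = insert w (P - {p})" by auto
      moreover have "linked E' (insert w (P - {p}))"
        using D(7)[OF 4(1)] 4 assms by (intro linked_subdivide[of E _ u v]) (auto simp: subdivided_def)
      ultimately show ?thesis by simp
    qed
  qed
  have "linked (E' - {(a, b), (b, a)}) (insert w P)"
    if ab: "a \<in> insert w P" "b \<in> insert w P" "(a, b) \<in> E'" for a b
  proof -
    have ins: "linked (E' - {(a, b), (b, a)}) (insert w P)"
      if "{a, b} = {w, x}" "y \<in> P" "(w, y) \<in> E'" "y \<noteq> x" for x y
    proof (rule linked_insert[OF _ \<open>y \<in> P\<close>])
      show "linked (E' - {(a, b), (b, a)}) P"
        using that(1) facts by (intro linked_mono[OF E0]) (auto simp: subdivided_def doubleton_eq_iff)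
      show "(w, y) \<in> E' - {(a, b), (b, a)}"
        using that facts by (auto simp: doubleton_eq_iff)
    qed
    show ?thesis
    proof (cases "a = w \<or> b = w")
      case True
      have "a \<noteq> b" using ab irrefl facts by (auto simp: subdivided_def irrefl_def)
      then have "{a, b} = {w, u} \<or> {a, b} = {w, v}"
        using True ab iff(2)[of a] iff(3)[of b] by auto
      then show ?thesis
        using ins[of u v] ins[of v u] assms facts iff(3)[of u] iff(3)[of v] by auto
    next
      case False
      then have "(a, b) \<in> E" "a \<in> P" "b \<in> P" "(a, b) \<noteq> (u, v)" "(a, b) \<noteq> (v, u)" using ab iff(1)[of a b] by auto
      moreover from this have "linked (E - {(a, b), (b, a)}) P" using D(8) by blast
      ultimately show ?thesis using assms False facts
        by (intro linked_subdivide[of "E - {(a, b), (b, a)}" P u v]) (auto simp: subdivided_def)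
    qed
  qed
  have "linked E' (insert w P)"
    using D(4) assms by (intro linked_subdivide[of E P u v]) (auto simp: subdivided_def)
  have "linked E' Q" using D(1,5) assms sub by (intro linked_unchanged) auto
  have "(p, q) \<notin> E'" if "p \<in> insert w P" "q \<in> Q" for p q
    using that D(1,10) assms facts by (auto simp: subdivided_def)
  have "\<exists>q\<in>Q. (m, q) \<in> E'" if m: "m \<in> M" for m
  proof -
    obtain q where "q \<in> Q" "(m, q) \<in> E" using D(12) m by blast
    moreover have "m \<noteq> u" "m \<noteq> v" "m \<noteq> w" "q \<noteq> w" using m D(2) assms facts calculation by auto
    ultimately show ?thesis by (auto simp: subdivided_def)
  qed
  have MP: "p \<in> insert w P \<and> (m, p) \<in> E' \<longleftrightarrow> p \<in> P \<and> (m, p) \<in> E" if "m \<in> M" for m p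
  proof -
    have "m \<noteq> u" "m \<noteq> v" "m \<noteq> w" using that D(2) assms facts by auto
    then show ?thesis using facts by (auto simp: subdivided_def)
  qed
  have "\<exists>!p. p \<in> insert w P \<and> (m, p) \<in> E'" if "m \<in> M" for m
    unfolding MP[OF that] using D(13)[OF that] .
  have "m = m'" if "p \<in> insert w P" "m \<in> M" "m' \<in> M" "(m, p) \<in> E'" "(m', p) \<in> E'" for p m m'
    using MP[of m p] MP[of m' p] that D(14) by blast
  have "\<exists>c\<in>insert w P. c \<noteq> a \<and> c \<noteq> b" for a b using D(9)[of a b] by blast
  have "insert w P \<inter> Q = {}" "M \<inter> insert w P = {}" using D(1,2) facts by auto
  show ?thesis by (intro frame.intro; fact)
qed

private lemma linked_P_unchanged:
  assumes "\<not> (u \<in> P \<and> v \<in> P)"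
  shows "linked E' P" "p \<in> P \<Longrightarrow> linked E' (P - {p})"
    "a \<in> P \<Longrightarrow> b \<in> P \<Longrightarrow> (a, b) \<in> E' \<Longrightarrow> linked (E' - {(a, b), (b, a)}) P"
proof -
  note D = frame.frame_facts[OF F]
  show "linked E' P" using D(4) assms sub by (intro linked_unchanged) auto
  show "linked E' (P - {p})" if "p \<in> P" using D(7)[OF that] assms sub by (intro linked_unchanged) auto
  show "linked (E' - {(a, b), (b, a)}) P" if "a \<in> P" "b \<in> P" "(a, b) \<in> E'"
  proof -
    have "(a, b) \<in> E" using that facts by (auto simp: subdivided_def)
    then show ?thesis
      using assms by (intro linked_mono[OF D(8)[OF that(1,2)]]) (auto simp: subdivided_def)
  qed
qed

text \<open>Common to all cases in which \<open>P\<close> and \<open>M\<close> stay as they are and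
  \<open>Q\<close> gains at most \<open>w\<close>.\<close>

private lemma frame_Q:
  assumes "\<not> (u \<in> P \<and> v \<in> P)" "\<not> (u \<in> P \<and> v \<in> M)" "\<not> (u \<in> M \<and> v \<in> P)"
    and Q': "linked E' Q'" "Q \<subseteq> Q'" "Q' \<subseteq> insert w Q" "w \<in> Q' \<Longrightarrow> u \<notin> P \<and> v \<notin> P"
    and MQ: "\<And>m. m \<in> M \<Longrightarrow> \<exists>q\<in>Q'. (m, q) \<in> E'"
  shows "frame E' P M Q'"
proof -
  note D = frame.frame_facts[OF F]
  have MP: "(m, p) \<in> E' \<longleftrightarrow> (m, p) \<in> E" if "m \<in> M" "p \<in> P" for m p
    using that assms facts by (auto simp: subdivided_def)
  have "(p, q) \<notin> E'" if "p \<in> P" "q \<in> Q'" for p q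
  proof (cases "q = w")
    case True
    then show ?thesis using that Q'(4) facts iff(2)[of p] by auto
  next
    case False
    then show ?thesis using that Q'(3) facts D(10) by (auto simp: subdivided_def)
  qed
  have "\<exists>!p. p \<in> P \<and> (m, p) \<in> E'" if "m \<in> M" for m
    using D(13)[OF that] MP[OF that] by metis
  have "P \<inter> Q' = {}" "M \<inter> Q' = {}" "Q' \<noteq> {}" using D(1,3,6) Q' facts by auto
  have "m = m'" if "p \<in> P" "m \<in> M" "m' \<in> M" "(m, p) \<in> E'" "(m', p) \<in> E'" for p m m'
    using that MP D(14) by blast
  note P = linked_P_unchanged[OF assms(1)]
  show ?thesis by (intro frame.intro; fact)
qed

text \<open>\<open>w\<close> replaces \<open>u\<close> in \<open>M\<close>, and \<open>u\<close>
  retreats into \<open>Q\<close>: its only neighbour in \<open>P\<close> was \<open>v\<close>, and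
  it keeps its edge to the old \<open>Q\<close>.\<close>

private lemma frame_MP:
  assumes "u \<in> M" "v \<in> P"
  shows "frame E' P (insert w (M - {u})) (insert u Q)"
proof -
  note D = frame.frame_facts[OF F]
  have un: "u \<notin> P" "v \<notin> M" "u \<notin> Q" "v \<notin> Q" using assms D(1,2,3) by auto
  have u_only: "p = v" if "p \<in> P" "(u, p) \<in> E" for p using D(13)[OF assms(1)] that assms uv by blast
  obtain q where q: "q \<in> Q" "(u, q) \<in> E" using D(12) assms by blast
  have "linked E' Q" using D(5) un sub by (intro linked_unchanged) auto
  then have Q: "linked E' (insert u Q)"
    using q un facts by (intro linked_insert[of E' Q q u]) (auto simp: subdivided_def)
  have M: "(m, p) \<in> E' \<longleftrightarrow> (m, p) \<in> E" if "m \<in> M - {u}" "p \<in> P" for m p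
    using that un facts by (auto simp: subdivided_def)
  have w: "(w, p) \<in> E' \<longleftrightarrow> p = v" if "p \<in> P" for p
    using that un facts by (auto simp: subdivided_def)
  have "(p, q) \<notin> E'" if "p \<in> P" "q \<in> insert u Q" for p q
  proof (cases "q = u")
    case True
    have "p = v" if "(p, u) \<in> E" using u_only \<open>p \<in> P\<close> that sym by (auto dest: symD)
    then show ?thesis using True that facts iff(1)[of p u] by blast
  next
    case False
    then show ?thesis using that facts D(10) by (auto simp: subdivided_def)
  qed
  have "3 \<le> card (insert w (M - {u}))"
    using D(11) assms facts card_gt_0_iff[of M] by (simp add: card_insert_if)
  have "\<exists>q\<in>insert u Q. (m, q) \<in> E'" if m: "m \<in> insert w (M - {u})" for m
  proof (cases "m = w")
    case True
    then show ?thesis using facts iff(3)[of u] by blast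
  next
    case False
    then obtain q where "q \<in> Q" "(m, q) \<in> E" using D(12) m by blast
    then have "(m, q) \<in> E'" using False m un facts by (auto simp: subdivided_def)
    then show ?thesis using \<open>q \<in> Q\<close> by blast
  qed
  have "\<exists>!p. p \<in> P \<and> (m, p) \<in> E'" if m: "m \<in> insert w (M - {u})" for m
  proof (cases "m = w")
    case True
    then show ?thesis using w assms by blast
  next
    case False
    then show ?thesis using M[of m] D(13)[of m] m by blast
  qed
  have "m = m'"
    if "p \<in> P" "m \<in> insert w (M - {u})" "m' \<in> insert w (M - {u})" "(m, p) \<in> E'" "(m', p) \<in> E'" for p m m'
  proof -
    have no: "(m, v) \<notin> E" if "m \<in> M - {u}" for m using D(14)[OF assms(2) _ assms(1)] that uv by blast
    show ?thesis using that w[of p] M[of m p] M[of m' p] no[of m] no[of m'] D(14)[of p m m'] by blast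
  qed
  have "P \<inter> insert u Q = {}" "insert w (M - {u}) \<inter> P = {}" "insert w (M - {u}) \<inter> insert u Q = {}"
    using D(1,2,3) un facts by auto
  have "\<not> (u \<in> P \<and> v \<in> P)" using un by blast
  note P = linked_P_unchanged[OF this]
  have "insert u Q \<noteq> {}" by simp
  show ?thesis by (intro frame.intro; fact)
qed

text \<open>\<open>w\<close> joins \<open>Q\<close>. If \<open>u\<close> is in \<open>M\<close>, it
  now reaches \<open>Q\<close> through \<open>w\<close>.\<close>

private lemma frame_QM:
  assumes "u \<in> Q \<union> M" "v \<in> Q"
  shows "frame E' P M (insert w Q)"
proof -
  note D = frame.frame_facts[OF F]
  have un: "u \<notin> P" "v \<notin> P" "v \<notin> M" using assms D(1,2,3) by auto
  show ?thesis
  proof (rule frame_Q)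
    show "linked E' (insert w Q)"
    proof (cases "u \<in> Q")
      case True
      then show ?thesis using D(5) assms by (intro linked_subdivide[of E Q u v]) (auto simp: subdivided_def)
    next
      case False
      then have "linked E' Q" using D(5) sub by (intro linked_unchanged) auto
      then show ?thesis using assms by (intro linked_insert[of E' Q v w]) (auto simp: subdivided_def)
    qed
    fix m assume m: "m \<in> M"
    then obtain q where q: "q \<in> Q" "(m, q) \<in> E" using D(12) by blast
    show "\<exists>q\<in>insert w Q. (m, q) \<in> E'"
    proof (cases "m = u")
      case True
      then show ?thesis by (auto simp: subdivided_def)
    next
      case False
      then have "(m, q) \<in> E'" using q m un facts by (auto simp: subdivided_def)
      then show ?thesis using q by blast
    qed
  qed (use un in auto)
qed

text \<open>What is left are edges inside \<open>M\<close> and edges with an end outside the three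
  sets; the frame relies on neither.\<close>

private lemma frame_other:
  assumes "\<not> (u \<in> P \<and> v \<in> P)" "\<not> (u \<in> P \<and> v \<in> M)" "\<not> (u \<in> M \<and> v \<in> P)"
    "\<not> (u \<in> Q \<union> M \<and> v \<in> Q)" "\<not> (u \<in> Q \<and> v \<in> Q \<union> M)"
  shows "frame E' P M Q"
proof (rule frame_Q)
  note D = frame.frame_facts[OF F]
  show "linked E' Q" using D(5) assms sub by (intro linked_unchanged) auto
  fix m assume m: "m \<in> M"
  then obtain q where q: "q \<in> Q" "(m, q) \<in> E" using D(12) by blast
  then have "(m, q) \<in> E'" using m assms facts by (auto simp: subdivided_def)
  then show "\<exists>q\<in>Q. (m, q) \<in> E'" using q by blast
qed (use assms facts in auto)

lemmas frame_subdivided_cases = frame_PP frame_MP frame_QM frame_other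

end

lemma frame_subdivided:
  assumes "sym E" "irrefl E" "E \<subseteq> V \<times> V" "(u, v) \<in> E" "w \<notin> V"
    and F: "frame E P M Q" "P \<subseteq> V" "M \<subseteq> V" "Q \<subseteq> V"
  shows "\<exists>P' M' Q'. frame (subdivided E u v w) P' M' Q' \<and>
    P' \<subseteq> insert w V \<and> M' \<subseteq> insert w V \<and> Q' \<subseteq> insert w V"
proof -
  have vu: "(v, u) \<in> E" "u \<in> V" "v \<in> V" using assms(1,3,4) by (auto dest: symD)
  consider "u \<in> P \<and> v \<in> P" | "u \<in> P \<and> v \<in> M" | "u \<in> M \<and> v \<in> P"
    | "u \<in> Q \<union> M \<and> v \<in> Q" | "u \<in> Q \<and> v \<in> Q \<union> M"
    | "\<not> (u \<in> P \<and> v \<in> P)" "\<not> (u \<in> P \<and> v \<in> M)" "\<not> (u \<in> M \<and> v \<in> P)"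
      "\<not> (u \<in> Q \<union> M \<and> v \<in> Q)" "\<not> (u \<in> Q \<and> v \<in> Q \<union> M)" by blast
  then show ?thesis
  proof cases
    case 1 then show ?thesis using frame_subdivided_cases(1)[OF assms] F(2-) by blast
  next
    case 2 then show ?thesis using frame_subdivided_cases(2)[OF assms(1-3) vu(1) assms(5-), unfolded subdivided_commute[of E v u]] F(2-) vu by blast
  next
    case 3 then show ?thesis using frame_subdivided_cases(2)[OF assms] F(2-) vu by blast
  next
    case 4 then show ?thesis using frame_subdivided_cases(3)[OF assms] F(2-) by blast
  next
    case 5 then show ?thesis using frame_subdivided_cases(3)[OF assms(1-3) vu(1) assms(5-), unfolded subdivided_commute[of E v u]] F(2-) by blast
  next
    case 6 then show ?thesis using frame_subdivided_cases(4)[OF assms] F(2-) by blast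
  qed
qed

section \<open>From frames to obstructions in line graphs\<close>

text \<open>Edges of \<open>F\<close> at a common vertex are adjacent in the line graph, so a
  predicate on edges descends to vertices, where connectedness of \<open>S\<close> applies.
  \<open>F\<close> may contain edges that leave \<open>S\<close>.\<close>

lemma linked_line_graph:
  assumes "linked E S" "\<And>e. e \<in> F \<Longrightarrow> e \<inter> S \<noteq> {}"
    and "\<And>x y. x \<in> S \<Longrightarrow> y \<in> S \<Longrightarrow> (x, y) \<in> E \<Longrightarrow> {x, y} \<in> F"
    and "\<And>e e'. e \<in> F \<Longrightarrow> e' \<in> F \<Longrightarrow> e \<noteq> e' \<Longrightarrow> e \<inter> e' \<noteq> {} \<Longrightarrow> (e, e') \<in> L"
  shows "linked L F"
proof (rule linkedI)
  fix f :: "_ \<Rightarrow> bool" and e e'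
  assume f: "\<And>e e'. e \<in> F \<Longrightarrow> e' \<in> F \<Longrightarrow> (e, e') \<in> L \<Longrightarrow> f e = f e'"
    and e: "e \<in> F" "e' \<in> F"
  define c where "c x \<longleftrightarrow> (\<exists>e\<in>F. x \<in> e \<and> f e)" for x
  have c: "f e = c x" if "e \<in> F" "x \<in> e" for e x
  proof -
    have "f e' = f e" if "e' \<in> F" "x \<in> e'" for e'
      using f[OF that(1) \<open>e \<in> F\<close>] assms(4)[OF that(1) \<open>e \<in> F\<close>] that \<open>x \<in> e\<close> by blast
    then show ?thesis using that unfolding c_def by blast
  qed
  obtain x y where xy: "x \<in> S" "x \<in> e" "y \<in> S" "y \<in> e'" using assms(2) e by blast
  have "c x = c y"
  proof (rule linkedD[OF assms(1) _ xy(1,3)])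
    fix a b assume "a \<in> S" "b \<in> S" "(a, b) \<in> E"
    then have "{a, b} \<in> F" by (rule assms(3))
    then show "c a = c b" using c[of "{a, b}" a] c[of "{a, b}" b] by simp
  qed
  then show "f e = f e'" using c e xy by metis
qed

text \<open>An edge from \<open>m\<close> to \<open>p\<close> touches exactly those edges of
  \<open>P'\<close> that contain \<open>p\<close>, so removing its neighbours leaves the edges
  inside \<open>P - {p}\<close>.\<close>

lemma frame_imp_line_graph_obstruction:
  assumes "frame E P M Q" and sym: "sym E"
    and L: "\<And>e e'. (e, e') \<in> L \<longleftrightarrow> e \<in> Ed \<and> e' \<in> Ed \<and> e \<noteq> e' \<and> e \<inter> e' \<noteq> {}"
    and Ed: "Ed = {{u, v} | u v. (u, v) \<in> E}"
  shows "\<exists>P' M' Q'. obstruction L P' M' Q' \<and> P' \<subseteq> Ed \<and> M' \<subseteq> Ed \<and> Q' \<subseteq> Ed"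
proof -
  interpret frame E P M Q by fact
  define P' where "P' = {{a, b} | a b. a \<in> P \<and> b \<in> P \<and> (a, b) \<in> E}"
  define M' where "M' = {{m, p} | m p. m \<in> M \<and> p \<in> P \<and> (m, p) \<in> E}"
  \<comment> \<open>Edges from \<open>Q\<close> to \<open>M\<close> are included, as these are the
    ones that touch the edges in \<open>M'\<close>.\<close>
  define Q' where "Q' = {{a, b} | a b. a \<in> Q \<and> b \<in> Q \<union> M \<and> (a, b) \<in> E}"
  have in_Ed: "P' \<subseteq> Ed" "M' \<subseteq> Ed" "Q' \<subseteq> Ed" unfolding P'_def M'_def Q'_def Ed by blast+
  have subs: "e \<subseteq> P" if "e \<in> P'" for e using that by (auto simp: P'_def)
  have subsQ: "e \<subseteq> Q \<union> M" "e \<inter> Q \<noteq> {}" if "e \<in> Q'" for e using that by (auto simp: Q'_def)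
  have P'_cases: "\<exists>a b. e = {a, b} \<and> a \<in> P \<and> b \<in> P \<and> (a, b) \<in> E" if "e \<in> P'" for e
    using that by (auto simp: P'_def)
  have M'_cases: "\<exists>m p. e = {m, p} \<and> m \<in> M \<and> p \<in> P \<and> (m, p) \<in> E" if "e \<in> M'" for e
    using that by (auto simp: M'_def)
  have "\<exists>p. m \<in> M \<longrightarrow> p \<in> P \<and> (m, p) \<in> E" for m using M_unique_edge_P[of m] by blast
  then obtain f where f: "\<And>m. m \<in> M \<Longrightarrow> f m \<in> P \<and> (m, f m) \<in> E" by metis
  have "inj_on (\<lambda>m. {m, f m}) M"
  proof (rule inj_onI)
    fix m m' assume "m \<in> M" "m' \<in> M" "{m, f m} = {m', f m'}"
    then show "m = m'" using f M_Int_P by (metis disjoint_iff doubleton_eq_iff)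
  qed
  moreover have "M' = (\<lambda>m. {m, f m}) ` M"
  proof -
    have "p = f m" if "m \<in> M" "p \<in> P" "(m, p) \<in> E" for m p
      using M_unique_edge_P[OF that(1)] f[OF that(1)] that(2,3) by blast
    then show ?thesis using f unfolding M'_def by blast
  qed
  ultimately have "card M' = card M" by (simp add: card_image)
  then have cardM': "3 \<le> card M'" using card_M by simp
  have linkedP': "linked L {{a, b} | a b. a \<in> S \<and> b \<in> S \<and> (a, b) \<in> E}" if "linked E S" for S
    using that by (rule linked_line_graph) (auto simp: L Ed)
  have "linked L P'" unfolding P'_def using linkedP' linked_P .
  moreover have "linked L Q'"
  proof (rule linked_line_graph[OF linked_Q])
    fix x y assume "x \<in> Q" "y \<in> Q" "(x, y) \<in> E"
    then show "{x, y} \<in> Q'" by (auto simp: Q'_def)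
  qed (use in_Ed subsQ in \<open>auto simp: L\<close>)
  moreover have MQ: "\<exists>e'\<in>Q'. (e, e') \<in> L" if "e \<in> M'" for e
  proof -
    obtain m p where e: "e = {m, p}" "m \<in> M" "p \<in> P" "(m, p) \<in> E" using M'_cases \<open>e \<in> M'\<close> by blast
    obtain q where q: "q \<in> Q" "(m, q) \<in> E" using M_edge_Q e by blast
    then have "(q, m) \<in> E" using sym by (auto dest: symD)
    then have "{q, m} \<in> Q'" using q e by (auto simp: Q'_def)
    moreover have "{m, p} \<noteq> {q, m}" using e q P_Int_Q by (auto simp: doubleton_eq_iff)
    ultimately show ?thesis using e in_Ed \<open>e \<in> M'\<close> by (intro bexI[of _ "{q, m}"]) (auto simp: L)
  qed
  moreover have adj: "({m, p}, e) \<in> L \<longleftrightarrow> p \<in> e" if "{m, p} \<in> M'" "e \<in> P'" "m \<in> M" "p \<in> P" for m p e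
    using that in_Ed subs[OF that(2)] M_Int_P by (auto simp: L)
  have rest: "linked L {e' \<in> P'. (e, e') \<notin> L}" if "e \<in> M'" for e
  proof -
    obtain m p where e: "e = {m, p}" "m \<in> M" "p \<in> P" "(m, p) \<in> E" using M'_cases \<open>e \<in> M'\<close> by blast
    have "{e' \<in> P'. (e, e') \<notin> L} = {e' \<in> P'. p \<notin> e'}" using adj[of m p] e \<open>e \<in> M'\<close> by blast
    also have "\<dots> = {{a, b} | a b. a \<in> P - {p} \<and> b \<in> P - {p} \<and> (a, b) \<in> E}"
      unfolding P'_def by blast
    finally show ?thesis using linkedP'[OF linked_P_minus_vertex[OF e(3)]] by simp
  qed
  moreover have diff: "\<exists>e\<in>P'. (e2, e) \<in> L \<and> (e1, e) \<notin> L" if e12: "e1 \<in> M'" "e2 \<in> M'" "e1 \<noteq> e2" for e1 e2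
  proof -
    obtain m1 p1 where 1: "e1 = {m1, p1}" "m1 \<in> M" "p1 \<in> P" "(m1, p1) \<in> E" using M'_cases e12(1) by blast
    obtain m2 p2 where 2: "e2 = {m2, p2}" "m2 \<in> M" "p2 \<in> P" "(m2, p2) \<in> E" using M'_cases e12(2) by blast
    have "p1 \<noteq> p2" using P_unique_edge_M[of p1 m1 m2] 1 2 e12(3) by blast
    \<comment> \<open>\<open>c\<close> is a vertex of \<open>P - {p1}\<close> besides
      \<open>p2\<close>, so \<open>p2\<close> has a neighbour \<open>z\<close> there; the edge
      between \<open>p2\<close> and \<open>z\<close> avoids \<open>p1\<close>.\<close>
    obtain c where c: "c \<in> P" "c \<noteq> p1" "c \<noteq> p2" using P_third_vertex by blast
    obtain z where z: "z \<in> P - {p1}" "(p2, z) \<in> E \<or> (z, p2) \<in> E"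
      using linked_neighbour[OF linked_P_minus_vertex[OF 1(3)], of p2 c] 2 c \<open>p1 \<noteq> p2\<close> by blast
    then have "(p2, z) \<in> E" using sym by (auto dest: symD)
    then have "{p2, z} \<in> P'" using z 2 by (auto simp: P'_def)
    moreover have "({m2, p2}, {p2, z}) \<in> L" using adj[of m2 p2] 2 e12 calculation by blast
    moreover have "({m1, p1}, {p2, z}) \<notin> L" using adj[of m1 p1] 1 e12 calculation(1) z \<open>p1 \<noteq> p2\<close> by blast
    ultimately show ?thesis using 1 2 by blast
  qed
  moreover have anti: "(e, e') \<notin> L" if "e \<in> P'" "e' \<in> Q'" for e e'
    using subs[OF that(1)] subsQ[OF that(2)] P_Int_Q M_Int_P by (auto simp: L)
  moreover have "P' \<inter> Q' = {}" using subs subsQ(2) P_Int_Q by blast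
  moreover have "M' \<inter> P' = {}"
  proof -
    have "e \<notin> P'" if "e \<in> M'" for e using M'_cases[OF that] subs[of e] M_Int_P by blast
    then show ?thesis by blast
  qed
  moreover have "M' \<inter> Q' = {}"
  proof -
    have "e \<notin> Q'" if "e \<in> M'" for e using M'_cases[OF that] subsQ[of e] M_Int_Q P_Int_Q by blast
    then show ?thesis by blast
  qed
  moreover have "Q' \<noteq> {}"
  proof -
    have "M' \<noteq> {}" using cardM' by auto
    then show ?thesis using MQ by blast
  qed
  ultimately have "obstruction L P' M' Q'"
    unfolding obstruction_def using cardM' by simp
  then show ?thesis using in_Ed by blast
qed

section \<open>A frame in the wall and in its subdivisions\<close>

lemma wall_arc_iff:
  "(x, y) \<in> parcs (wall t) \<longleftrightarrow> (x, y) \<in> parcs (wall_with_pendants t) \<and> x \<in> pverts (wall t) \<and> y \<in> pverts (wall t)"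
  by (simp add: wall_def Let_def)

lemma wall_with_pendants_arc_iff:
  "((i, j), (i', j')) \<in> parcs (wall_with_pendants t) \<longleftrightarrow>
     {i, i'} \<subseteq> {1..t} \<and> {j, j'} \<subseteq> {1..2 * t} \<and>
     (i = i' \<and> (j' = j + 1 \<or> j = j' + 1) \<or>
      j = j' \<and> (i' = i + 1 \<and> even (i + j) \<or> i = i' + 1 \<and> even (i' + j)))"
  by (auto simp: wall_with_pendants_def wall_grid_def Let_def)

text \<open>Only vertices of degree one are deleted, so two neighbours certify survival.\<close>

lemma in_wall_verts:
  assumes "(x, y) \<in> parcs (wall_with_pendants t)" "(x, z) \<in> parcs (wall_with_pendants t)" "y \<noteq> z"
  shows "x \<in> pverts (wall t)"
proof -
  let ?W = "with_proj (wall_with_pendants t)"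
  have "parcs (wall_with_pendants t) \<subseteq> pverts (wall_grid t) \<times> pverts (wall_grid t)"
    by (auto simp: wall_with_pendants_def wall_grid_def Let_def)
  then have "x \<in> pverts (wall_with_pendants t)"
    using assms(1) by (auto simp: wall_with_pendants_def Let_def)
  moreover have "out_degree ?W x \<noteq> 1"
  proof
    assume "out_degree ?W x = 1"
    then obtain a where "out_arcs ?W x = {a}" by (auto simp: out_degree_def card_1_singleton_iff)
    moreover have "(x, y) \<in> out_arcs ?W x" "(x, z) \<in> out_arcs ?W x" using assms by (auto simp: out_arcs_def)
    ultimately show False using assms(3) by auto
  qed
  ultimately show ?thesis by (simp add: wall_def Let_def)
qed

lemma pair_graph_wall: "pair_graph (wall t)"
proof
  have fin: "finite (pverts (wall t))"
    by (rule finite_subset[of _ "{1..t} \<times> {1..2 * t}"])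
      (auto simp: wall_def wall_with_pendants_def wall_grid_def Let_def)
  then show "finite (pverts (wall t))" .
  have "parcs (wall t) \<subseteq> pverts (wall t) \<times> pverts (wall t)" by (auto simp: wall_def Let_def)
  then show "finite (parcs (wall t))" using fin by (blast intro: finite_subset)
  show "fst e \<noteq> snd e" if "e \<in> parcs (wall t)" for e
    using that by (cases e) (auto simp: wall_arc_iff wall_with_pendants_arc_iff)
  show "symmetric (with_proj (wall t))"
    unfolding symmetric_def by (auto intro!: symI simp: wall_arc_iff wall_with_pendants_arc_iff)
qed (auto simp: wall_def Let_def)

lemma wall_frame:
  assumes "4 \<le> t"
  shows "\<exists>P M Q. frame (parcs (wall t)) P M Q \<and>
    P \<subseteq> pverts (wall t) \<and> M \<subseteq> pverts (wall t) \<and> Q \<subseteq> pverts (wall t)"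
proof -
  \<comment> \<open>A brick, three of its outer neighbours, and a path around it that meets all three.\<close>
  define c :: "(nat \<times> nat) list" where "c = [(2,2), (2,3), (2,4), (3,4), (3,3), (3,2)]"
  define P where "P = set c"
  define M :: "(nat \<times> nat) set" where "M = {(1,3), (2,5), (3,5)}"
  define Q where "Q = set [(1,4), (1,5), (1,6), (1,7), (2,7), (2,6), (3::nat,6::nat)]"
  let ?W = "wall_with_pendants t"
  \<comment> \<open>Horizontal neighbours of these vertices lie in columns 1 to 8, hence the bound
    \<open>4 \<le> t\<close>.\<close>
  have box: "P \<union> M \<union> Q \<subseteq> {1..3} \<times> {2..7}" by (auto simp: P_def c_def M_def Q_def)
  have V: "x \<in> pverts (wall t)" if "x \<in> P \<union> M \<union> Q" for x
  proof -
    have "x \<in> {1..3} \<times> {2..7}" using that box by blast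
    then obtain i j where x: "x = (i, j)" "1 \<le> i" "i \<le> 3" "2 \<le> j" "j \<le> 7" by auto
    then have "(x, (i, j + 1)) \<in> parcs ?W" "(x, (i, j - 1)) \<in> parcs ?W"
      using assms by (auto simp: wall_with_pendants_arc_iff)
    then show ?thesis by (rule in_wall_verts) simp
  qed
  \<comment> \<open>Adjacency without the bounds on coordinates, so that the remaining claims are
    evaluations on explicit finite sets.\<close>
  define adj :: "nat \<times> nat \<Rightarrow> nat \<times> nat \<Rightarrow> bool" where
    "adj = (\<lambda>(i, j) (i', j'). i = i' \<and> (j' = j + 1 \<or> j = j' + 1) \<or>
      j = j' \<and> (i' = i + 1 \<and> even (i + j) \<or> i = i' + 1 \<and> even (i' + j)))"
  have E: "(x, y) \<in> parcs (wall t) \<longleftrightarrow> adj x y" if xy: "x \<in> P \<union> M \<union> Q" "y \<in> P \<union> M \<union> Q" for x y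
  proof -
    obtain i j i' j' where ij: "x = (i, j)" "y = (i', j')" by fastforce
    have "(i, j) \<in> {1..3} \<times> {2..7}" "(i', j') \<in> {1..3} \<times> {2..7}" using xy box ij by blast+
    then have "{i, i'} \<subseteq> {1..t} \<and> {j, j'} \<subseteq> {1..2 * t}" using assms by auto
    then show ?thesis
      unfolding wall_arc_iff adj_def ij wall_with_pendants_arc_iff using V[OF xy(1)] V[OF xy(2)] ij by simp
  qed
  have sets: "P = {(2,2), (2,3), (2,4), (3,4), (3,3), (3,2)}"
    "Q = {(1,4), (1,5), (1,6), (1,7), (2,7), (2,6), (3,6)}" by (auto simp: P_def c_def Q_def)
  let ?E = "parcs (wall t)"
  have path: "linked (?E - X) S" if "set xs = S" "\<forall>e\<in>set (vwalk_arcs xs). e \<in> ?E \<and> e \<notin> X" for X xs S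
    using linked_path[of xs "?E - X"] that by blast
  \<comment> \<open>The six-cycle without one edge is a path, listed from one end of the deleted
    edge to the other; each edge is treated in turn.\<close>
  have e1: "linked (?E - {((2,2), (2,3)), ((2,3), (2,2))}) P"
    by (rule path[of "[(2,3), (2,4), (3,4), (3,3), (3,2), (2,2)]"]) (auto simp: E sets M_def adj_def)
  have e2: "linked (?E - {((2,3), (2,4)), ((2,4), (2,3))}) P"
    by (rule path[of "[(2,4), (3,4), (3,3), (3,2), (2,2), (2,3)]"]) (auto simp: E sets M_def adj_def)
  have e3: "linked (?E - {((2,4), (3,4)), ((3,4), (2,4))}) P"
    by (rule path[of "[(3,4), (3,3), (3,2), (2,2), (2,3), (2,4)]"]) (auto simp: E sets M_def adj_def)
  have e4: "linked (?E - {((3,4), (3,3)), ((3,3), (3,4))}) P"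
    by (rule path[of "[(3,3), (3,2), (2,2), (2,3), (2,4), (3,4)]"]) (auto simp: E sets M_def adj_def)
  have e5: "linked (?E - {((3,3), (3,2)), ((3,2), (3,3))}) P"
    by (rule path[of "[(3,2), (2,2), (2,3), (2,4), (3,4), (3,3)]"]) (auto simp: E sets M_def adj_def)
  have e6: "linked (?E - {((3,2), (2,2)), ((2,2), (3,2))}) P"
    by (rule path[of "[(2,2), (2,3), (2,4), (3,4), (3,3), (3,2)]"]) (auto simp: E sets M_def adj_def)
  have cyc: "\<forall>a\<in>P. \<forall>b\<in>P. adj a b \<longrightarrow>
    (a, b) \<in> set (zip c (rotate1 c)) \<or> (b, a) \<in> set (zip c (rotate1 c))"
    by (simp add: sets adj_def c_def)
  have minus_edge: "linked (?E - {(a, b), (b, a)}) P"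
    if "a \<in> P" "b \<in> P" "(a, b) \<in> ?E" for a b
  proof -
    have "(a, b) \<in> set (zip c (rotate1 c)) \<or> (b, a) \<in> set (zip c (rotate1 c))"
      using cyc that E[of a b] by blast
    then show ?thesis
      using e1 e2 e3 e4 e5 e6 insert_commute[of "(a, b)" "(b, a)" "{}"] unfolding c_def by auto
  qed
  have minus_vertex: "linked ?E (P - {p})" if "p \<in> P" for p
  proof -
    note path' = path[where X = "{}", simplified]
    have "linked ?E (P - {(2,2)})"
      by (rule path'[of "[(2,3), (2,4), (3,4), (3,3), (3,2)]"]) (auto simp: E sets M_def adj_def)
    moreover have "linked ?E (P - {(2,3)})"
      by (rule path'[of "[(2,4), (3,4), (3,3), (3,2), (2,2)]"]) (auto simp: E sets M_def adj_def)
    moreover have "linked ?E (P - {(2,4)})"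
      by (rule path'[of "[(3,4), (3,3), (3,2), (2,2), (2,3)]"]) (auto simp: E sets M_def adj_def)
    moreover have "linked ?E (P - {(3,4)})"
      by (rule path'[of "[(3,3), (3,2), (2,2), (2,3), (2,4)]"]) (auto simp: E sets M_def adj_def)
    moreover have "linked ?E (P - {(3,3)})"
      by (rule path'[of "[(3,2), (2,2), (2,3), (2,4), (3,4)]"]) (auto simp: E sets M_def adj_def)
    moreover have "linked ?E (P - {(3,2)})"
      by (rule path'[of "[(2,2), (2,3), (2,4), (3,4), (3,3)]"]) (auto simp: E sets M_def adj_def)
    ultimately show ?thesis using that unfolding sets(1) by blast
  qed
  have MP: "(m, p) \<in> ?E \<longleftrightarrow> (m, p) \<in> {((1,3), (2,3)), ((2,5), (2,4)), ((3,5), (3,4))}"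
    if "m \<in> M" "p \<in> P" for m p
  proof -
    have "\<forall>m\<in>M. \<forall>p\<in>P. adj m p \<longleftrightarrow> (m, p) \<in> {((1,3), (2,3)), ((2,5), (2,4)), ((3,5), (3,4))}"
      by (simp add: sets M_def adj_def)
    then show ?thesis using that E[of m p] by blast
  qed
  have "frame ?E P M Q"
  proof
    show "linked ?E P" unfolding P_def by (rule linked_path) (auto simp: E c_def M_def sets adj_def)
    show "linked ?E Q" unfolding Q_def by (rule linked_path) (auto simp: E M_def sets adj_def)
    show "\<exists>c\<in>P. c \<noteq> a \<and> c \<noteq> b" for a b
    proof -
      have "card P = 6" by (simp add: sets)
      moreover have "card {a, b} \<le> 2" by (simp add: card_insert_if)
      ultimately have "\<not> P \<subseteq> {a, b}" using card_mono[of "{a, b}" P] by auto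
      then show ?thesis by blast
    qed
    show "(p, q) \<notin> ?E" if "p \<in> P" "q \<in> Q" for p q
    proof -
      have "\<forall>p\<in>P. \<forall>q\<in>Q. \<not> adj p q" by (simp add: sets adj_def)
      then show ?thesis using that E[of p q] by blast
    qed
    show "\<exists>q\<in>Q. (m, q) \<in> ?E" if "m \<in> M" for m
      using that by (auto simp: M_def E sets adj_def)
    show "\<exists>!p. p \<in> P \<and> (m, p) \<in> ?E" if m: "m \<in> M" for m
    proof -
      obtain p where "p \<in> P" "(m, p) \<in> {((1,3), (2,3)), ((2,5), (2,4)), ((3,5), (3,4))}"
        using m unfolding M_def sets by auto
      then show ?thesis using MP[OF m] by (intro ex1I[of _ p]) auto
    qed
    show "m = m'" if "p \<in> P" "m \<in> M" "m' \<in> M" "(m, p) \<in> ?E" "(m', p) \<in> ?E" for p m m'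
      using that MP[of m p] MP[of m' p] by auto
  qed (use minus_edge minus_vertex in \<open>auto simp: sets M_def\<close>)
  then show ?thesis using V by blast
qed

lemma subdivided_wall_frame:
  assumes "subdivision_pair (wall t) W" "4 \<le> t"
  shows "\<exists>P M Q. frame (parcs W) P M Q \<and> P \<subseteq> pverts W \<and> M \<subseteq> pverts W \<and> Q \<subseteq> pverts W"
    and "pair_graph W"
proof -
  have "pair_graph W \<and> (\<exists>P M Q. frame (parcs W) P M Q \<and> P \<subseteq> pverts W \<and> M \<subseteq> pverts W \<and> Q \<subseteq> pverts W)"
    using assms(1)
  proof (induction rule: subdivision_pair_induct)
    case base
    then show ?case using wall_frame[OF assms(2)] pair_graph_wall by blast
  next
    case (divide e w H)
    then obtain P M Q where F: "frame (parcs H) P M Q" "P \<subseteq> pverts H" "M \<subseteq> pverts H" "Q \<subseteq> pverts H"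
      by blast
    interpret H: pair_graph H using divide by blast
    obtain u v where e: "e = (u, v)" by (cases e)
    have "sym (parcs H)" using H.arcs_symmetric by (auto intro: symI)
    moreover have "irrefl (parcs H)" using H.no_loops[of "(_, _)"] by (force simp: irrefl_def)
    moreover have "parcs H \<subseteq> pverts H \<times> pverts H" by (auto dest: H.wellformed)
    moreover have "parcs (subdivide H e w) = subdivided (parcs H) u v w" "pverts (subdivide H e w) = insert w (pverts H)"
      by (auto simp: e subdivided_def)
    ultimately show ?case
      using frame_subdivided[of "parcs H" "pverts H" u v w P M Q] F divide e H.pair_graph_subdivide[of e w] by simp
  qed
  then show "\<exists>P M Q. frame (parcs W) P M Q \<and> P \<subseteq> pverts W \<and> M \<subseteq> pverts W \<and> Q \<subseteq> pverts W"
    and "pair_graph W" by blast+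
qed

lemma chord_model_no_wall:
  assumes G: "chord_model (parcs G) (pverts G) l h" and W: "subdivision_pair (wall t) W" "4 \<le> t"
  shows "\<not> contains_induced G W" "\<not> contains_induced G (line_graph W)"
proof -
  obtain P M Q where F: "frame (parcs W) P M Q" "P \<subseteq> pverts W" "M \<subseteq> pverts W" "Q \<subseteq> pverts W"
    using subdivided_wall_frame[OF W] by blast
  interpret W: pair_graph W using subdivided_wall_frame[OF W] by blast
  show "\<not> contains_induced G W"
  proof
    assume "contains_induced G W"
    then obtain l' h' where "chord_model (parcs W) (pverts W) l' h'" using chord_model_induced[OF G] by blast
    then show False
      using chord_model_no_obstruction[OF _ _ F(2-4) frame_imp_obstruction[OF F(1)]] W.pair_finite_verts by blast
  qed
  show "\<not> contains_induced G (line_graph W)"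
  proof
    let ?L = "line_graph W"
    let ?Ed = "{{u, v} | u v. (u, v) \<in> parcs W}"
    assume "contains_induced G ?L"
    then obtain l' h' where m: "chord_model (parcs ?L) (pverts ?L) l' h'" using chord_model_induced[OF G] by blast
    have V: "pverts ?L = ?Ed" by (simp add: line_graph_def Let_def)
    have L: "(e, e') \<in> parcs ?L \<longleftrightarrow> e \<in> ?Ed \<and> e' \<in> ?Ed \<and> e \<noteq> e' \<and> e \<inter> e' \<noteq> {}" for e e'
      by (simp add: line_graph_def Let_def)
    have "?Ed = (\<lambda>(u, v). {u, v}) ` parcs W" by auto
    then have fin: "finite (pverts ?L)" unfolding V by simp
    have "sym (parcs W)" using W.arcs_symmetric by (auto intro: symI)
    then obtain P' M' Q' where "obstruction (parcs ?L) P' M' Q'" "P' \<subseteq> ?Ed" "M' \<subseteq> ?Ed" "Q' \<subseteq> ?Ed"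
      using frame_imp_line_graph_obstruction[OF F(1) _ L refl] by blast
    then show False using chord_model_no_obstruction[OF m fin] unfolding V by blast
  qed
qed

subsection \<open>Realising chord diagrams by chords in general position\<close>

text \<open>Stereographic projection from \<open>-1\<close>. Being rational, it turns the geometry
  into polynomial identities; the missed point \<open>-1\<close> is where the circle is cut
  open.\<close>

definition circle_point :: "real \<Rightarrow> complex" where
  "circle_point t = Complex ((1 - t\<^sup>2) / (1 + t\<^sup>2)) (2 * t / (1 + t\<^sup>2))"

text \<open>
  The line through \<open>circle_point s\<close> and \<open>circle_point t\<close> is the zero set of this form.
\<close>

definition chord_form :: "real \<Rightarrow> real \<Rightarrow> complex \<Rightarrow> real" where
  "chord_form s t z = Re z - 1 + (s + t) * Im z - s * t * (Re z + 1)"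

lemma one_plus_square_pos: "0 < 1 + (t :: real)\<^sup>2"
  by (simp add: add_pos_nonneg)

text \<open>Up to a positive factor the value is \<open>- (u - s) * (u - t)\<close>, whose sign
  tells on which of the two arcs the point lies.\<close>

lemma chord_form_circle_point:
  "chord_form s t (circle_point u) = - 2 * ((u - s) * (u - t)) / (1 + u\<^sup>2)"
proof -
  define x where "x = Re (circle_point u)"
  define y where "y = Im (circle_point u)"
  have k: "1 + u\<^sup>2 \<noteq> 0" using one_plus_square_pos[of u] by simp
  then have "(1 + u\<^sup>2) * x = 1 - u\<^sup>2" "(1 + u\<^sup>2) * y = 2 * u"
    by (simp_all add: x_def y_def circle_point_def)
  then have "(x - 1 + (s + t) * y - s * t * (x + 1)) * (1 + u\<^sup>2) = - 2 * ((u - s) * (u - t))"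
    by algebra
  then show ?thesis
    unfolding chord_form_def x_def y_def by (rule nonzero_eq_divide_eq[OF k, THEN iffD2])
qed

lemma chord_form_convex:
  "chord_form s t ((1 - r) *\<^sub>R x + r *\<^sub>R y) = (1 - r) * chord_form s t x + r * chord_form s t y"
  by (simp add: chord_form_def algebra_simps)

lemma circle_point_inj: "circle_point s = circle_point t \<longleftrightarrow> s = t"
proof
  assume "circle_point s = circle_point t"
  then have "chord_form s s (circle_point t) = chord_form s s (circle_point s)" by simp
  then show "s = t" using one_plus_square_pos[of t] by (simp add: chord_form_circle_point)
qed simp

lemma circle_point_in_sphere: "circle_point t \<in> sphere 0 1"
proof -
  have "(1 - t\<^sup>2)\<^sup>2 + (2 * t)\<^sup>2 = (1 + t\<^sup>2)\<^sup>2" by algebra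
  then have "((1 - t\<^sup>2) / (1 + t\<^sup>2))\<^sup>2 + (2 * t / (1 + t\<^sup>2))\<^sup>2 = 1"
    using one_plus_square_pos[of t]
    by (simp add: power_divide add_divide_distrib[symmetric] del: power_mult_distrib)
  then show ?thesis by (simp add: circle_point_def cmod_def)
qed

definition chord :: "real \<Rightarrow> real \<Rightarrow> complex set" where
  "chord s t = closed_segment (circle_point s) (circle_point t)"

lemma chord_commute: "chord s t = chord t s"
  by (simp add: chord_def closed_segment_commute)

lemma chord_form_on_chord: "z \<in> chord s t \<Longrightarrow> chord_form s t z = 0"
  by (auto simp: chord_def closed_segment_def chord_form_convex chord_form_circle_point)

text \<open>The form is affine, so a strict sign shared by both ends of a chord persists along it.
  The factor \<open>r\<close>, later 1 or -1, covers both signs at once.\<close>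

lemma chord_form_sign:
  assumes "z \<in> chord u v" "(u - s) * (u - t) * r > 0" "(v - s) * (v - t) * r > 0"
  shows "chord_form s t z \<noteq> 0"
proof -
  obtain k where k: "0 \<le> k" "k \<le> 1" "z = (1 - k) *\<^sub>R circle_point u + k *\<^sub>R circle_point v"
    using assms(1) by (auto simp: chord_def closed_segment_def)
  define A where "A = (u - s) * (u - t) * r / (1 + u\<^sup>2)"
  define B where "B = (v - s) * (v - t) * r / (1 + v\<^sup>2)"
  have "A > 0" "B > 0" unfolding A_def B_def using assms one_plus_square_pos by (auto intro: divide_pos_pos)
  have "0 < (1 - k) * A + k * B"
  proof (cases "k = 0")
    case False
    then have "0 < k * B" using k \<open>B > 0\<close> by simp
    then show ?thesis using k \<open>A > 0\<close> by (simp add: add_nonneg_pos)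
  qed (use \<open>A > 0\<close> in simp)
  moreover have "chord_form s t z * r = - 2 * ((1 - k) * A + k * B)"
    unfolding k chord_form_convex chord_form_circle_point A_def B_def by (simp add: algebra_simps)
  ultimately have "chord_form s t z * r < 0" by (simp only: mult_neg_pos neg_less_0_iff_less zero_less_numeral)
  then show ?thesis by auto
qed

lemma in_closed_segment_if_weights:
  fixes p x y :: complex
  assumes "w1 > 0" "w2 > 0" "(w1 + w2) * Re p = w1 * Re x + w2 * Re y" "(w1 + w2) * Im p = w1 * Im x + w2 * Im y"
  shows "p \<in> closed_segment x y"
proof -
  have "w1 + w2 \<noteq> 0" using assms by simp
  then have "1 - w2 / (w1 + w2) = w1 / (w1 + w2)" "Re p = (w1 * Re x + w2 * Re y) / (w1 + w2)"
    "Im p = (w1 * Im x + w2 * Im y) / (w1 + w2)"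
    using assms(3,4) by (simp_all add: diff_divide_eq_iff nonzero_eq_divide_eq mult.commute)
  then have "p = (1 - w2 / (w1 + w2)) *\<^sub>R x + (w2 / (w1 + w2)) *\<^sub>R y"
    by (simp add: complex_eq_iff add_divide_distrib)
  moreover have "0 \<le> w2 / (w1 + w2)" "w2 / (w1 + w2) \<le> 1" using assms by auto
  ultimately show ?thesis unfolding closed_segment_def by blast
qed

lemma chords_meet:
  assumes "a < c" "c < b" "b < d"
  shows "chord a b \<inter> chord c d \<noteq> {}"
proof -
  \<comment> \<open>The intersection point of the two lines is \<open>(X / S, Y / S)\<close>; the weights express it as a convex combination.\<close>
  define S where "S = (a + b - c - d) + (a * b * (c + d) - c * d * (a + b))"
  define X where "X = (a + b - c - d) - (a * b * (c + d) - c * d * (a + b))"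
  define Y where "Y = 2 * (a * b - c * d)"
  have sq: "1 + a\<^sup>2 \<noteq> 0" "1 + b\<^sup>2 \<noteq> 0" "1 + c\<^sup>2 \<noteq> 0" "1 + d\<^sup>2 \<noteq> 0"
    using one_plus_square_pos[of a] one_plus_square_pos[of b] one_plus_square_pos[of c] one_plus_square_pos[of d] by auto
  \<comment> \<open>The weight of an end is, up to a common positive factor, the absolute value of
    the other chord's form at the opposite end; so the weighted mean is a zero of that form.\<close>
  define wa where "wa = (b - c) * (d - b) * (1 + a\<^sup>2)"
  define wb where "wb = (c - a) * (d - a) * (1 + b\<^sup>2)"
  define wc where "wc = (d - a) * (d - b) * (1 + c\<^sup>2)"
  define wd where "wd = (c - a) * (b - c) * (1 + d\<^sup>2)"
  have w: "wa > 0" "wb > 0" "wc > 0" "wd > 0"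
    unfolding wa_def wb_def wc_def wd_def using assms one_plus_square_pos by (auto intro!: mult_pos_pos)
  have sums: "wa + wb = - (b - a) * S" "wc + wd = - (d - c) * S"
    unfolding wa_def wb_def wc_def wd_def S_def by algebra+
  then have "S \<noteq> 0" using w by auto
  define p where "p = Complex (X / S) (Y / S)"
  have wz: "w * (1 + t\<^sup>2) * Re (circle_point t) = w * (1 - t\<^sup>2)" "w * (1 + t\<^sup>2) * Im (circle_point t) = w * (2 * t)" for w t
    using one_plus_square_pos[of t] by (auto simp: circle_point_def)
  have "p \<in> chord a b" unfolding chord_def
  proof (rule in_closed_segment_if_weights[OF w(1,2)])
    have "(wa + wb) * Re p = - (b - a) * X" using \<open>S \<noteq> 0\<close> by (simp add: sums p_def)
    also have "\<dots> = wa * Re (circle_point a) + wb * Re (circle_point b)"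
      unfolding wa_def wb_def wz X_def by algebra
    finally show "(wa + wb) * Re p = wa * Re (circle_point a) + wb * Re (circle_point b)" .
    have "(wa + wb) * Im p = - (b - a) * Y" using \<open>S \<noteq> 0\<close> by (simp add: sums p_def)
    also have "\<dots> = wa * Im (circle_point a) + wb * Im (circle_point b)"
      unfolding wa_def wb_def wz Y_def by algebra
    finally show "(wa + wb) * Im p = wa * Im (circle_point a) + wb * Im (circle_point b)" .
  qed
  moreover have "p \<in> chord c d" unfolding chord_def
  proof (rule in_closed_segment_if_weights[OF w(3,4)])
    have "(wc + wd) * Re p = - (d - c) * X" using \<open>S \<noteq> 0\<close> by (simp add: sums p_def)
    also have "\<dots> = wc * Re (circle_point c) + wd * Re (circle_point d)"
      unfolding wc_def wd_def wz X_def by algebra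
    finally show "(wc + wd) * Re p = wc * Re (circle_point c) + wd * Re (circle_point d)" .
    have "(wc + wd) * Im p = - (d - c) * Y" using \<open>S \<noteq> 0\<close> by (simp add: sums p_def)
    also have "\<dots> = wc * Im (circle_point c) + wd * Im (circle_point d)"
      unfolding wc_def wd_def wz Y_def by algebra
    finally show "(wc + wd) * Im p = wc * Im (circle_point c) + wd * Im (circle_point d)" .
  qed
  ultimately show ?thesis by blast
qed

lemma chords_meet_if_separated:
  assumes "a < b" "c < d" "distinct [a, b, c, d]" "((a < c) \<noteq> (b < c)) \<noteq> ((a < d) \<noteq> (b < d))"
  shows "chord a b \<inter> chord c d \<noteq> {}"
proof (cases "a < c")
  case True
  then have "c < b" "b < d" using assms by (cases "b < c"; simp)+
  then show ?thesis using chords_meet True by blast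
next
  case False
  then have "c < a" "c < b" using assms by simp_all
  then have "a < d" "d < b" using assms by (cases "a < d"; cases "b < d"; simp)+
  then show ?thesis using chords_meet[of c a d b] \<open>c < a\<close> by blast
qed

lemma chords_meet_iff:
  assumes "distinct [a, b, c, d]"
  shows "chord a b \<inter> chord c d \<noteq> {} \<longleftrightarrow> ((a < c) \<noteq> (b < c)) \<noteq> ((a < d) \<noteq> (b < d))"
proof (intro iffI)
  assume sep: "((a < c) \<noteq> (b < c)) \<noteq> ((a < d) \<noteq> (b < d))"
  have "a < b \<or> b < a" "c < d \<or> d < c" using assms by auto
  then consider "a < b" "c < d" | "a < b" "d < c" | "b < a" "c < d" | "b < a" "d < c" by blast
  then show "chord a b \<inter> chord c d \<noteq> {}"
  proof cases
    case 1
    show ?thesis by (rule chords_meet_if_separated[OF 1 assms sep])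
  next
    case 2
    have "chord a b \<inter> chord d c \<noteq> {}"
      by (rule chords_meet_if_separated[OF 2]) (use assms sep in auto)
    then show ?thesis by (simp add: chord_commute[of d c])
  next
    case 3
    have "chord b a \<inter> chord c d \<noteq> {}"
      by (rule chords_meet_if_separated[OF 3]) (use assms sep in auto)
    then show ?thesis by (simp add: chord_commute[of b a])
  next
    case 4
    have "chord b a \<inter> chord d c \<noteq> {}"
      by (rule chords_meet_if_separated[OF 4]) (use assms sep in auto)
    then show ?thesis by (simp add: chord_commute[of b a] chord_commute[of d c])
  qed
next
  assume "chord a b \<inter> chord c d \<noteq> {}"
  then obtain p where p: "p \<in> chord a b" "p \<in> chord c d" by auto
  have neg: "(x - a) * (x - b) < 0 \<longleftrightarrow> (a < x) \<noteq> (b < x)" "(x - a) * (x - b) > 0 \<longleftrightarrow> (a < x) = (b < x)"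
    if "x \<noteq> a" "x \<noteq> b" for x
    using that by (auto simp: mult_less_0_iff zero_less_mult_iff)
  show "((a < c) \<noteq> (b < c)) \<noteq> ((a < d) \<noteq> (b < d))"
  proof (rule ccontr)
    assume "\<not> ?thesis"
    then have "(c - a) * (c - b) * 1 > 0 \<and> (d - a) * (d - b) * 1 > 0 \<or>
        (c - a) * (c - b) * (-1) > 0 \<and> (d - a) * (d - b) * (-1) > 0"
      using neg[of c] neg[of d] assms by auto
    then have "chord_form a b p \<noteq> 0"
      using chord_form_sign[OF p(2), of a b 1] chord_form_sign[OF p(2), of a b "-1"] by blast
    then show False using chord_form_on_chord[OF p(1)] by simp
  qed
qed

text \<open>
  The determinant of the coefficient vectors \<open>(1, s + t, s t)\<close> of three chord forms.
\<close>

definition concurrency :: "real \<Rightarrow> real \<Rightarrow> real \<Rightarrow> real \<Rightarrow> real \<Rightarrow> real \<Rightarrow> real" where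
  "concurrency a b c d e f =
     (c + d) * (e * f) - c * d * (e + f) - (a + b) * (e * f - c * d) + a * b * (e + f - c - d)"

lemma concurrency_eq_0:
  assumes "p \<in> chord a b" "p \<in> chord c d" "p \<in> chord e f"
  shows "concurrency a b c d e f = 0"
proof -
  have "chord_form a b p = 0" "chord_form c d p = 0" "chord_form e f p = 0"
    using assms chord_form_on_chord by auto
  \<comment> \<open>The vector \<open>(Re p - 1, Im p, - (Re p + 1))\<close> is a nonzero element of the kernel.\<close>
  then show ?thesis unfolding chord_form_def concurrency_def by algebra
qed

lemma concurrency_permute:
  "concurrency b a c d e f = concurrency a b c d e f"
  "concurrency c d a b e f = - concurrency a b c d e f"
  "concurrency e f c d a b = - concurrency a b c d e f"
  by (simp_all add: concurrency_def algebra_simps)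

text \<open>The expression is affine in \<open>t\<close>, so two roots would make it vanish
  identically. This forces \<open>q = 0\<close> and \<open>p = 0\<close>: the pairs
  \<open>c\<close>, \<open>d\<close> and \<open>e\<close>, \<open>f\<close> then have equal sum and
  product, hence coincide.\<close>

lemma finite_concurrency_roots:
  assumes "distinct [b, c, d, e, f]"
  shows "finite {t. concurrency t b c d e f = 0}"
proof -
  have "s = t" if s: "concurrency s b c d e f = 0" and t: "concurrency t b c d e f = 0" for s t
  proof (rule ccontr)
    assume "s \<noteq> t"
    define p where "p = e * f - c * d"
    define q where "q = e + f - c - d"
    have "(s - t) * (b * q - p) = 0" using s t unfolding concurrency_def p_def q_def by algebra
    then have p: "p = b * q" using \<open>s \<noteq> t\<close> by simp
    then have "q * ((b - c) * (b - d)) = 0" using s unfolding concurrency_def p_def q_def by algebra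
    then have "q = 0" using assms by auto
    then have "(e - c) * (e - d) = 0" using p unfolding p_def q_def by algebra
    then show False using assms by auto
  qed
  then have "\<exists>s. {t. concurrency t b c d e f = 0} \<subseteq> {s}" by blast
  then show ?thesis using finite_subset by blast
qed

text \<open>Points are added one by one, to the right of all earlier ones and off the finitely many
  roots given by five old points. The symmetries of \<open>concurrency\<close> bring the new point
  into the first argument.\<close>

lemma general_position:
  "\<exists>\<tau> :: nat \<Rightarrow> real. (\<forall>i j. i < j \<longrightarrow> j < N \<longrightarrow> \<tau> i < \<tau> j) \<and>
     (\<forall>a b c d e f. {a, b, c, d, e, f} \<subseteq> {..<N} \<longrightarrow> distinct [a, b, c, d, e, f] \<longrightarrow>
        concurrency (\<tau> a) (\<tau> b) (\<tau> c) (\<tau> d) (\<tau> e) (\<tau> f) \<noteq> 0)"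
proof (induction N)
  case (Suc N)
  then obtain \<tau> :: "nat \<Rightarrow> real" where mono: "\<And>i j. i < j \<Longrightarrow> j < N \<Longrightarrow> \<tau> i < \<tau> j"
    and gp: "\<And>a b c d e f. {a, b, c, d, e, f} \<subseteq> {..<N} \<Longrightarrow> distinct [a, b, c, d, e, f] \<Longrightarrow>
        concurrency (\<tau> a) (\<tau> b) (\<tau> c) (\<tau> d) (\<tau> e) (\<tau> f) \<noteq> 0" by blast
  have inj: "\<tau> i \<noteq> \<tau> j" if "i \<noteq> j" "i < N" "j < N" for i j
    using mono[of i j] mono[of j i] that by (cases "i < j") auto
  define I where "I = {xs :: nat list. set xs \<subseteq> {..<N} \<and> length xs = 5 \<and> distinct xs}"
  have "finite I" by (rule finite_subset[OF _ finite_lists_length_eq[of "{..<N}" 5]]) (auto simp: I_def)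
  define roots where "roots xs = {t. concurrency t (\<tau> (xs ! 0)) (\<tau> (xs ! 1)) (\<tau> (xs ! 2)) (\<tau> (xs ! 3)) (\<tau> (xs ! 4)) = 0}" for xs
  have "finite (roots xs)" if "xs \<in> I" for xs
  proof -
    have "length xs = 5" using that by (simp add: I_def)
    then obtain b c d e f where xs: "xs = [b, c, d, e, f]" by (auto simp: length_Suc_conv numeral_eq_Suc)
    show ?thesis unfolding roots_def using that
      by (intro finite_concurrency_roots) (auto simp: I_def xs inj)
  qed
  then have fin: "finite (\<Union>xs\<in>I. roots xs)" using \<open>finite I\<close> by blast
  \<comment> \<open>Inserting 0 makes \<open>Max\<close> meaningful for
    \<open>N = 0\<close>.\<close>
  define m where "m = Max (insert 0 (\<tau> ` {..<N}))"
  have m: "\<tau> i \<le> m" if "i < N" for i using that by (auto simp: m_def intro!: Max_ge)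
  have "infinite ({m<..} - (\<Union>xs\<in>I. roots xs))" using fin infinite_Ioi by (rule Diff_infinite_finite)
  then obtain t where t: "m < t" "t \<notin> (\<Union>xs\<in>I. roots xs)"
    by (metis Diff_iff equals0I finite.emptyI greaterThan_iff)
  have new: "concurrency t (\<tau> b) (\<tau> c) (\<tau> d) (\<tau> e) (\<tau> f) \<noteq> 0"
    if "{b, c, d, e, f} \<subseteq> {..<N}" "distinct [b, c, d, e, f]" for b c d e f
  proof -
    have "[b, c, d, e, f] \<in> I" using that by (simp add: I_def)
    then have "t \<notin> roots [b, c, d, e, f]" using t by blast
    then show ?thesis by (simp add: roots_def)
  qed
  let ?\<tau> = "\<tau>(N := t)"
  have "?\<tau> i < ?\<tau> j" if "i < j" "j < Suc N" for i j
    using that mono[of i j] m[of i] t(1) by auto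
  moreover have "concurrency (?\<tau> a) (?\<tau> b) (?\<tau> c) (?\<tau> d) (?\<tau> e) (?\<tau> f) \<noteq> 0"
    if sub: "{a, b, c, d, e, f} \<subseteq> {..<Suc N}" and dist: "distinct [a, b, c, d, e, f]" for a b c d e f
  proof -
    consider "{a, b, c, d, e, f} \<subseteq> {..<N}" | "a = N" | "b = N" | "c = N" | "d = N" | "e = N" | "f = N"
      using sub less_Suc_eq by auto
    then show ?thesis
    proof cases
      case 1
      then show ?thesis using gp[OF 1 dist] by auto
    next
      case 2
      then have "{b, c, d, e, f} \<subseteq> {..<N}" using sub dist by (auto simp: less_Suc_eq)
      then show ?thesis using new[of b c d e f] 2 dist by auto
    next
      case 3
      then have "{a, c, d, e, f} \<subseteq> {..<N}" using sub dist by (auto simp: less_Suc_eq)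
      then show ?thesis using new[of a c d e f] 3 dist concurrency_permute(1) by auto
    next
      case 4
      then have "{a, b, d, e, f} \<subseteq> {..<N}" using sub dist by (auto simp: less_Suc_eq)
      then show ?thesis using new[of d a b e f] 4 dist concurrency_permute(2)[of "\<tau> a" "\<tau> b"] by auto
    next
      case 5
      then have "{a, b, c, e, f} \<subseteq> {..<N}" using sub dist by (auto simp: less_Suc_eq)
      then show ?thesis using new[of c a b e f] 5 dist concurrency_permute(2)[of "\<tau> a" "\<tau> b"]
          concurrency_permute(1)[of "\<tau> c"] by auto
    next
      case 6
      then have "{a, b, c, d, f} \<subseteq> {..<N}" using sub dist by (auto simp: less_Suc_eq)
      then show ?thesis using new[of f c d a b] 6 dist concurrency_permute(3)[of "\<tau> a" "\<tau> b"] by auto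
    next
      case 7
      then have "{a, b, c, d, e} \<subseteq> {..<N}" using sub dist by (auto simp: less_Suc_eq)
      then show ?thesis using new[of e c d a b] 7 dist concurrency_permute(3)[of "\<tau> a" "\<tau> b"]
          concurrency_permute(1)[of "\<tau> e"] by auto
    qed
  qed
  ultimately show ?case by blast
qed auto

section \<open>From chord models to circle graphs\<close>

lemma is_endpoint_iff: "is_endpoint x (closed_segment a b) \<longleftrightarrow> x = a \<or> x = b"
  by (auto simp: is_endpoint_def doubleton_eq_iff)

lemma circle_graph_if_chord_model:
  assumes model: "chord_model (parcs G) (pverts G) l h" and G: "pair_graph G"
  shows "circle_graph G"
proof -
  interpret pair_graph G by fact
  let ?V = "pverts G"
  define N where "N = Suc (Max (l ` ?V \<union> h ` ?V))"
  have N: "l v < N" "h v < N" if "v \<in> ?V" for v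
    using that by (auto simp: N_def less_Suc_eq_le)
  obtain \<tau> :: "nat \<Rightarrow> real" where mono: "\<And>i j. i < j \<Longrightarrow> j < N \<Longrightarrow> \<tau> i < \<tau> j"
    and gp: "\<And>a b c d e f. {a, b, c, d, e, f} \<subseteq> {..<N} \<Longrightarrow> distinct [a, b, c, d, e, f] \<Longrightarrow>
        concurrency (\<tau> a) (\<tau> b) (\<tau> c) (\<tau> d) (\<tau> e) (\<tau> f) \<noteq> 0" using general_position[of N] by blast
  have less: "\<tau> i < \<tau> j \<longleftrightarrow> i < j" if "i < N" "j < N" for i j
    using mono[of i j] mono[of j i] that by (cases i j rule: linorder_cases) auto
  have eq: "\<tau> i = \<tau> j \<longleftrightarrow> i = j" if "i < N" "j < N" for i j
    using less[OF that] less[OF that(2,1)] by (metis linorder_neq_iff)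
  have loop: "l u \<noteq> h u" if "u \<in> ?V" for u using model that by (auto simp: chord_model_def)
  have dist: "l u \<noteq> l v" "l u \<noteq> h v" "h u \<noteq> l v" "h u \<noteq> h v" if "u \<in> ?V" "v \<in> ?V" "u \<noteq> v" for u v
    using model that unfolding chord_model_def by metis+
  define s where "s v = chord (\<tau> (l v)) (\<tau> (h v))" for v
  have s_seg: "s v = closed_segment (circle_point (\<tau> (l v))) (circle_point (\<tau> (h v)))" for v
    by (simp add: s_def chord_def)
  have inj: "inj_on s ?V"
  proof (rule inj_onI, rule ccontr)
    fix u v assume uv: "u \<in> ?V" "v \<in> ?V" "s u = s v" "u \<noteq> v"
    then show False using dist[OF uv(1,2,4)] N[OF uv(1)] N[OF uv(2)]
      by (auto simp: s_seg doubleton_eq_iff circle_point_inj eq)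
  qed
  have meet: "s u \<inter> s v \<noteq> {} \<longleftrightarrow> (u, v) \<in> parcs G" if "u \<in> ?V" "v \<in> ?V" "u \<noteq> v" for u v
  proof -
    have "(u, v) \<in> parcs G \<longleftrightarrow> interlaced l h u v" using model that unfolding chord_model_def by blast
    then show ?thesis
      unfolding s_def using chords_meet_iff[of "\<tau> (l u)" "\<tau> (h u)" "\<tau> (l v)" "\<tau> (h v)"]
        loop that dist[OF that] N by (simp add: eq less interlaced_def separated_def)
  qed
  \<comment> \<open>No chord passes through an end of another one, so meeting and crossing
    coincide.\<close>
  have no_end: "\<not> is_endpoint p (s u)" if uv: "u \<in> ?V" "v \<in> ?V" "u \<noteq> v" "p \<in> s v" for p u v
  proof -
    have "circle_point (\<tau> x) \<notin> s v" if "x < N" "x \<noteq> l v" "x \<noteq> h v" for x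
    proof
      assume "circle_point (\<tau> x) \<in> s v"
      then have "chord_form (\<tau> (l v)) (\<tau> (h v)) (circle_point (\<tau> x)) = 0"
        unfolding s_def by (rule chord_form_on_chord)
      then show False using that uv N[of v] one_plus_square_pos[of "\<tau> x"] by (auto simp: chord_form_circle_point eq)
    qed
    then show ?thesis using uv dist[OF uv(1-3)] N[OF uv(1)] unfolding s_seg is_endpoint_iff by auto
  qed
  have cross: "(\<exists>p. cross_at (s u) (s v) p) \<longleftrightarrow> (u, v) \<in> parcs G" if "u \<in> ?V" "v \<in> ?V" for u v
  proof (cases "u = v")
    case True
    then show ?thesis using no_loops[of "(u, v)"] by (auto simp: cross_at_def)
  next
    case False
    have "s u \<noteq> s v" using inj that False by (auto dest: inj_onD)
    then have "(\<exists>p. cross_at (s u) (s v) p) \<longleftrightarrow> s u \<inter> s v \<noteq> {}"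
      using no_end[OF that False] no_end[OF that(2,1)] False by (auto simp: cross_at_def)
    then show ?thesis using meet that False by simp
  qed
  let ?S = "s ` ?V"
  have "is_chord 0 1 C" if "C \<in> ?S" for C
  proof -
    obtain v where v: "v \<in> ?V" "C = s v" using \<open>C \<in> ?S\<close> by blast
    then have "circle_point (\<tau> (l v)) \<noteq> circle_point (\<tau> (h v))"
      using N loop by (simp add: circle_point_inj eq)
    then show ?thesis using v circle_point_in_sphere unfolding is_chord_def s_seg by blast
  qed
  moreover have "\<not> (\<exists>C\<in>?S. \<exists>D\<in>?S. \<exists>E\<in>?S. \<exists>p. cross_at C D p \<and> cross_at D E p \<and> cross_at C E p)"
  proof
    assume "\<exists>C\<in>?S. \<exists>D\<in>?S. \<exists>E\<in>?S. \<exists>p. cross_at C D p \<and> cross_at D E p \<and> cross_at C E p"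
    then obtain u v w p where uvw: "u \<in> ?V" "v \<in> ?V" "w \<in> ?V"
      and cr: "cross_at (s u) (s v) p" "cross_at (s v) (s w) p" "cross_at (s u) (s w) p" by blast
    then have p: "p \<in> s u" "p \<in> s v" "p \<in> s w" by (simp_all add: cross_at_def)
    have ne: "u \<noteq> v" "v \<noteq> w" "u \<noteq> w" using cr by (auto simp: cross_at_def)
    have "concurrency (\<tau> (l u)) (\<tau> (h u)) (\<tau> (l v)) (\<tau> (h v)) (\<tau> (l w)) (\<tau> (h w)) = 0"
      using p unfolding s_def by (rule concurrency_eq_0)
    moreover have "distinct [l u, h u, l v, h v, l w, h w]"
      using loop uvw dist[OF uvw(1,2) ne(1)] dist[OF uvw(2,3) ne(2)] dist[OF uvw(1,3) ne(3)] by simp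
    ultimately show False using gp[of "l u" "h u" "l v" "h v" "l w" "h w"] N uvw by auto
  qed
  moreover have "digraph_iso (with_proj (crossing_graph ?S)) (with_proj G)"
  proof -
    let ?f = "the_inv_into ?V s"
    have f: "?f (s v) = v" if "v \<in> ?V" for v using the_inv_into_f_f[OF inj that] .
    have "pair_wf_digraph (crossing_graph ?S)" by unfold_locales (auto simp: crossing_graph_def)
    moreover have "inj_on ?f ?S" by (rule inj_on_the_inv_into[OF inj])
    moreover have "?V = ?f ` ?S" using f by force
    moreover have "parcs G = map_prod ?f ?f ` parcs (crossing_graph ?S)"
    proof (intro set_eqI iffI)
      fix e assume e: "e \<in> parcs G"
      obtain u v where uv: "e = (u, v)" "u \<in> ?V" "v \<in> ?V"
        using e arc_fst_in_verts[of e] arc_snd_in_verts[of e] by (cases e) auto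
      then have "(s u, s v) \<in> parcs (crossing_graph ?S)" using cross e by (auto simp: crossing_graph_def)
      then show "e \<in> map_prod ?f ?f ` parcs (crossing_graph ?S)"
        using f[OF uv(2)] f[OF uv(3)] uv(1) by (intro image_eqI[of _ _ "(s u, s v)"]) simp_all
    next
      fix e assume "e \<in> map_prod ?f ?f ` parcs (crossing_graph ?S)"
      then obtain u v where "u \<in> ?V" "v \<in> ?V" "e = (u, v)" "\<exists>p. cross_at (s u) (s v) p"
        using f by (auto simp: crossing_graph_def)
      then show "e \<in> parcs G" using cross by blast
    qed
    ultimately show ?thesis unfolding digraph_iso_pair_iff by (auto simp: crossing_graph_def)
  qed
  moreover have "finite ?S" by simp
  ultimately show ?thesis unfolding circle_graph_def
    by - (rule exI[of _ 0], rule exI[of _ 1], rule exI[of _ ?S], intro conjI ballI; (assumption | simp))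
qed

subsection \<open>Nested chains of chords\<close>

text \<open>
  A chord is named by its left endpoint. Passing to the next level moves an old endpoint \<open>a\<close> to
  \<open>3 a + 2\<close> and adds, for each such position, the chord from \<open>3 a\<close> to \<open>3 a + 4\<close>.
\<close>

fun lefts :: "nat \<Rightarrow> nat set" and width :: "nat \<Rightarrow> nat" where
  "lefts 0 = {0}"
| "lefts (Suc k) = (\<lambda>a. 3 * a + 2) ` lefts k \<union> (\<lambda>j. 3 * j) ` {..<width k}"
| "width 0 = 2"
| "width (Suc k) = 3 * width k + 2"

text \<open>Old left ends are 2 modulo 3 and new ones 0 modulo 3, so the residue of a name tells
  which kind of chord it is.\<close>

fun right :: "nat \<Rightarrow> nat \<Rightarrow> nat" where
  "right 0 x = 1"
| "right (Suc k) x = (if x mod 3 = 2 then 3 * right k (x div 3) + 2 else x + 4)"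

definition crosses :: "nat \<Rightarrow> nat \<Rightarrow> nat \<Rightarrow> bool" where
  "crosses k x y \<longleftrightarrow> x < y \<and> y < right k x \<and> right k x < right k y \<or>
     y < x \<and> x < right k y \<and> right k y < right k x"

definition chain_graph :: "nat \<Rightarrow> nat pair_pre_digraph" where
  "chain_graph k = \<lparr>pverts = lefts k, parcs = {(x, y). x \<in> lefts k \<and> y \<in> lefts k \<and> crosses k x y}\<rparr>"

lemma right_old [simp]:
  "right (Suc k) (3 * a + 2) = 3 * right k a + 2"
  "right (Suc k) (Suc (Suc (3 * a))) = 3 * right k a + 2"
proof -
  have "(3 * a + 2) mod 3 = 2" "(3 * a + 2) div 3 = a" by presburger+
  then show "right (Suc k) (3 * a + 2) = 3 * right k a + 2" by simp
  then show "right (Suc k) (Suc (Suc (3 * a))) = 3 * right k a + 2" by simp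
qed

lemma right_new [simp]: "right (Suc k) (3 * j) = 3 * j + 4"
  by simp

lemma lefts_bounds: "x \<in> lefts k \<Longrightarrow> x < right k x \<and> right k x < width k"
proof (induction k arbitrary: x)
  case (Suc k)
  then consider a where "x = 3 * a + 2" "a \<in> lefts k" | j where "x = 3 * j" "j < width k" by auto
  then show ?case
  proof cases
    case 1
    then show ?thesis using Suc.IH[of a] by (simp del: right.simps)
  next
    case 2
    then show ?thesis by (simp del: right.simps)
  qed
qed simp

declare right.simps(2) [simp del]

lemma finite_lefts: "finite (lefts k)"
  by (induction k) auto

text \<open>Modulo 3, old ends are 2, new left ends 0 and new right ends 1.\<close>

lemma distinct_endpoints:
  "x \<in> lefts k \<Longrightarrow> y \<in> lefts k \<Longrightarrow> x \<noteq> right k y \<and> (x \<noteq> y \<longrightarrow> right k x \<noteq> right k y)"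
proof (induction k arbitrary: x y)
  case (Suc k)
  have cases: "(\<exists>a\<in>lefts k. x = 3 * a + 2) \<or> (\<exists>j<width k. x = 3 * j)" if "x \<in> lefts (Suc k)" for x
    using that by auto
  have "3 * j \<noteq> 3 * i + (2 :: nat)" "3 * j + 4 \<noteq> 3 * i + (2 :: nat)" "3 * j \<noteq> 3 * i + (4 :: nat)" for i j
    by presburger+
  then show ?case using cases[OF Suc.prems(1)] cases[OF Suc.prems(2)] Suc.IH by fastforce
qed simp

lemma crosses_old:
  "crosses (Suc k) (3 * a + 2) (3 * b + 2) \<longleftrightarrow> crosses k a b"
  "crosses (Suc k) (Suc (Suc (3 * a))) (Suc (Suc (3 * b))) \<longleftrightarrow> crosses k a b"
  by (auto simp: crosses_def)

text \<open>New chords have length 4 and are spaced by 3: consecutive ones overlap, while those two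
  apart start at distance 6.\<close>

lemma crosses_new: "crosses (Suc k) (3 * i) (3 * j) \<longleftrightarrow> i = j + 1 \<or> j = i + 1"
  by (auto simp: crosses_def)

text \<open>The only moved position \<open>3 * b + 2\<close> between \<open>3 * j\<close> and
  \<open>3 * j + 4\<close> is that of \<open>b = j\<close>, so a new chord crosses an old one iff it
  covers one of its ends.\<close>

lemma crosses_old_new:
  assumes "a < right k a"
  shows "crosses (Suc k) (3 * a + 2) (3 * j) \<longleftrightarrow> j = a \<or> j = right k a"
  using assms unfolding crosses_def right_old right_new by presburger

lemma crosses_sym: "crosses k x y \<longleftrightarrow> crosses k y x"
  by (auto simp: crosses_def)

lemma pair_graph_chain_graph: "pair_graph (chain_graph k)"
proof
  show "finite (pverts (chain_graph k))" by (simp add: chain_graph_def finite_lefts)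
  show "finite (parcs (chain_graph k))"
    by (rule finite_subset[of _ "lefts k \<times> lefts k"]) (auto simp: chain_graph_def finite_lefts)
  show "symmetric (with_proj (chain_graph k))"
    unfolding symmetric_def by (auto intro!: symI simp: chain_graph_def crosses_sym)
qed (auto simp: chain_graph_def crosses_def)

lemma chain_graph_chord_model: "chord_model (parcs (chain_graph k)) (pverts (chain_graph k)) id (right k)"
proof -
  have "crosses k u v \<longleftrightarrow> interlaced id (right k) u v" if "u \<in> lefts k" "v \<in> lefts k" "u \<noteq> v" for u v
  proof -
    have "u < right k u" "v < right k v" "u \<noteq> right k v" "v \<noteq> right k u" "right k u \<noteq> right k v"
      using that lefts_bounds distinct_endpoints by blast+
    then show ?thesis
      using that(3) by (cases "u < v"; cases "right k u < right k v") (auto simp: crosses_def interlaced_def separated_def)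
  qed
  then show ?thesis
    using distinct_endpoints lefts_bounds unfolding chord_model_def chain_graph_def by fastforce
qed

text \<open>Take a chord of the newest level if \<open>S\<close> has one; otherwise \<open>S\<close>
  is a shifted copy of a set one level down.\<close>

lemma chain_graph_degenerate: "degenerate 3 (parcs (chain_graph k)) (lefts k)"
proof (induction k)
  case 0
  show ?case unfolding degenerate_def by (auto simp: chain_graph_def crosses_def)
next
  case (Suc k)
  show ?case unfolding degenerate_def
  proof (intro allI impI)
    fix S assume S: "S \<subseteq> lefts (Suc k)" "S \<noteq> {}"
    let ?E = "parcs (chain_graph (Suc k))"
    have fin: "finite (?E `` {v} \<inter> S)" for v using finite_subset[OF S(1) finite_lefts] by blast
    show "\<exists>v\<in>S. finite (?E `` {v} \<inter> S) \<and> card (?E `` {v} \<inter> S) \<le> 3"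
    proof (cases "\<exists>j. 3 * j \<in> S")
      case True
      then obtain j where j: "3 * j \<in> S" by blast
      \<comment> \<open>Chords with an end at position \<open>j\<close>; there is at most one
        because all ends are distinct.\<close>
      let ?old = "{a \<in> lefts k. j = a \<or> j = right k a}"
      have fin_old: "finite ?old" using finite_lefts by simp
      have "card ?old \<le> 1"
      proof -
        have "a = b" if "a \<in> ?old" "b \<in> ?old" for a b using that distinct_endpoints by fastforce
        then show ?thesis using finite_lefts card_le_Suc0_iff_eq[of ?old] by auto
      qed
      then have "card ((\<lambda>a. 3 * a + 2) ` ?old) \<le> 1"
        using card_image_le[OF fin_old, of "\<lambda>a. 3 * a + 2"] by linarith
      \<comment> \<open>For \<open>j = 0\<close> the truncated \<open>j - 1\<close> puts
        \<open>3 * j\<close> itself into the set, which is harmless for an upper bound.\<close>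
      moreover have "card {3 * (j + 1), 3 * (j - 1)} \<le> 2" by (simp add: card_insert_if)
      ultimately have "card ((\<lambda>a. 3 * a + 2) ` ?old \<union> {3 * (j + 1), 3 * (j - 1)}) \<le> 3"
        using card_Un_le[of "(\<lambda>a. 3 * a + 2) ` ?old" "{3 * (j + 1), 3 * (j - 1)}"] by linarith
      moreover have "?E `` {3 * j} \<inter> S \<subseteq> (\<lambda>a. 3 * a + 2) ` ?old \<union> {3 * (j + 1), 3 * (j - 1)}"
      proof
        fix y assume "y \<in> ?E `` {3 * j} \<inter> S"
        then have y: "y \<in> lefts (Suc k)" "crosses (Suc k) (3 * j) y" by (auto simp: chain_graph_def)
        then consider a where "y = 3 * a + 2" "a \<in> lefts k" | i where "y = 3 * i" by auto
        then show "y \<in> (\<lambda>a. 3 * a + 2) ` ?old \<union> {3 * (j + 1), 3 * (j - 1)}"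
        proof cases
          case 1
          then have "j = a \<or> j = right k a"
            using y crosses_sym crosses_old_new[of a k j] lefts_bounds by blast
          then show ?thesis using 1 by blast
        next
          case 2
          then show ?thesis using y crosses_new[of k j i] by auto
        qed
      qed
      ultimately have "card (?E `` {3 * j} \<inter> S) \<le> 3"
        using card_mono[of "(\<lambda>a. 3 * a + 2) ` ?old \<union> {3 * (j + 1), 3 * (j - 1)}"] fin_old
        by (meson finite.emptyI finite.insertI finite_UnI finite_imageI order_trans)
      then show ?thesis using j fin by blast
    next
      case False
      define S' where "S' = {a. 3 * a + 2 \<in> S}"
      have S': "S' \<subseteq> lefts k" "S' \<noteq> {}" "S = (\<lambda>a. 3 * a + 2) ` S'"
      proof -
        have "\<exists>a\<in>lefts k. x = 3 * a + 2" if "x \<in> S" for x using that S(1) False by auto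
        then show "S = (\<lambda>a. 3 * a + 2) ` S'" "S' \<noteq> {}" using S(2) unfolding S'_def by blast+
        show "S' \<subseteq> lefts k" using \<open>\<And>x. x \<in> S \<Longrightarrow> \<exists>a\<in>lefts k. x = 3 * a + 2\<close> unfolding S'_def by fastforce
      qed
      obtain v where v: "v \<in> S'" "card (parcs (chain_graph k) `` {v} \<inter> S') \<le> 3"
        using Suc S' unfolding degenerate_def by blast
      have "?E `` {3 * v + 2} \<inter> S \<subseteq> (\<lambda>a. 3 * a + 2) ` (parcs (chain_graph k) `` {v} \<inter> S')"
      proof
        fix y assume "y \<in> ?E `` {3 * v + 2} \<inter> S"
        then obtain a where a: "a \<in> S'" "y = 3 * a + 2" "crosses (Suc k) (3 * v + 2) (3 * a + 2)"
          unfolding S'(3) by (auto simp: chain_graph_def)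
        then have "(v, a) \<in> parcs (chain_graph k)" using v S'(1) by (auto simp: chain_graph_def crosses_old)
        then show "y \<in> (\<lambda>a. 3 * a + 2) ` (parcs (chain_graph k) `` {v} \<inter> S')" using a by blast
      qed
      moreover have fin': "finite (parcs (chain_graph k) `` {v} \<inter> S')"
        using finite_subset[OF S'(1) finite_lefts] by blast
      ultimately have "card (?E `` {3 * v + 2} \<inter> S) \<le> card (parcs (chain_graph k) `` {v} \<inter> S')"
        using card_mono[of "(\<lambda>a. 3 * a + 2) ` (parcs (chain_graph k) `` {v} \<inter> S')"] card_image_le[OF fin']
        by (meson finite_imageI order_trans)
      then show ?thesis using v S'(3) fin by (intro bexI[of _ "3 * v + 2"]) auto
    qed
  qed
qed

text \<open>The chain has a chord for every \<open>j < width k\<close>, also at positions that carry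
  no end, so consecutive indices are always present.\<close>

lemma linked_new_level: "linked (parcs (chain_graph (Suc k))) ((\<lambda>j. 3 * j) ` {..<width k})"
proof -
  have "linked {(i, j). j = i + 1} {..<n}" for n :: nat
  proof (rule linkedI)
    fix P :: "nat \<Rightarrow> bool" and x y
    assume P: "\<And>x y. x \<in> {..<n} \<Longrightarrow> y \<in> {..<n} \<Longrightarrow> (x, y) \<in> {(i, j). j = i + 1} \<Longrightarrow> P x = P y"
      and xy: "x \<in> {..<n}" "y \<in> {..<n}"
    have "P z = P 0" if "z < n" for z
      using that by (induction z) (use P in force)+
    then have "P x = P 0" "P y = P 0" using xy by blast+
    then show "P x = P y" by simp
  qed
  then show ?thesis
  proof (rule linked_image)
    fix x y assume "x \<in> {..<width k}" "y \<in> {..<width k}" "(x, y) \<in> {(i, j). j = i + 1}"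
    then have "3 * x \<in> lefts (Suc k)" "3 * y \<in> lefts (Suc k)" "crosses (Suc k) (3 * x) (3 * y)"
      by (auto simp only: lefts.simps crosses_new)
    then show "(3 * x, 3 * y) \<in> parcs (chain_graph (Suc k))" by (simp add: chain_graph_def)
  qed
qed

text \<open>\<open>X i\<close> is the \<open>i\<close>-th level, carried along by the shifts. An old
  level touches the newest one because the new chord over the left end of an old chord crosses
  it.\<close>

lemma chain_graph_bramble:
  "\<exists>X :: nat \<Rightarrow> nat set. (\<forall>i\<le>k. X i \<subseteq> lefts k \<and> X i \<noteq> {} \<and> linked (parcs (chain_graph k)) (X i)) \<and>
     (\<forall>i\<le>k. \<forall>j\<le>k. i \<noteq> j \<longrightarrow> X i \<inter> X j = {} \<and> (\<exists>u\<in>X i. \<exists>v\<in>X j. crosses k u v))"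
proof (induction k)
  case 0
  show ?case by (intro exI[of _ "\<lambda>_. {0}"]) (auto simp: linked_def)
next
  case (Suc k)
  obtain X where X0: "\<forall>i\<le>k. X i \<subseteq> lefts k \<and> X i \<noteq> {} \<and> linked (parcs (chain_graph k)) (X i)"
    and disj0: "\<forall>i\<le>k. \<forall>j\<le>k. i \<noteq> j \<longrightarrow> X i \<inter> X j = {} \<and> (\<exists>u\<in>X i. \<exists>v\<in>X j. crosses k u v)"
    using Suc.IH by (elim exE conjE) (rule that)
  have X: "X i \<subseteq> lefts k \<and> X i \<noteq> {} \<and> linked (parcs (chain_graph k)) (X i)" if "i \<le> k" for i
    using X0 that by simp
  have disj: "X i \<inter> X j = {} \<and> (\<exists>u\<in>X i. \<exists>v\<in>X j. crosses k u v)" if "i \<le> k" "j \<le> k" "i \<noteq> j" for i j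
    using disj0 that by simp
  let ?f = "\<lambda>a :: nat. 3 * a + 2"
  let ?new = "(\<lambda>j. 3 * j) ` {..<width k}"
  define Y where "Y i = (if i \<le> k then ?f ` X i else ?new)" for i
  have Y: "Y i = ?f ` X i" if "i \<le> k" for i using that by (simp add: Y_def)
  have Ynew: "Y (Suc k) = ?new" by (simp add: Y_def)
  have inj: "inj ?f" by (simp add: inj_on_def)
  have old_new: "Y i \<inter> ?new = {} \<and> (\<exists>u\<in>Y i. \<exists>v\<in>?new. crosses (Suc k) u v)" if i: "i \<le> k" for i
  proof
    have "3 * a + 2 \<noteq> 3 * (b :: nat)" for a b by presburger
    then show "Y i \<inter> ?new = {}" unfolding Y[OF i] by blast
    obtain a where a: "a \<in> X i" "a \<in> lefts k" using X[OF i] by blast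
    then have "crosses (Suc k) (3 * a + 2) (3 * a)" "a < width k"
      using crosses_old_new[of a k a] lefts_bounds[of a k] by auto
    then show "\<exists>u\<in>Y i. \<exists>v\<in>?new. crosses (Suc k) u v" using a unfolding Y[OF i] by blast
  qed
  have "Y i \<subseteq> lefts (Suc k) \<and> Y i \<noteq> {} \<and> linked (parcs (chain_graph (Suc k))) (Y i)" if i: "i \<le> Suc k" for i
  proof (cases "i \<le> k")
    case True
    have "linked (parcs (chain_graph (Suc k))) (?f ` X i)"
      by (rule linked_image[of "parcs (chain_graph k)"]) (use X[OF True] in \<open>auto simp: chain_graph_def crosses_old\<close>)
    then show ?thesis using X[OF True] Y[OF True] by auto
  next
    case False
    then have "i = Suc k" using i by simp
    moreover have "width k \<noteq> 0" by (cases k) auto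
    ultimately show ?thesis using linked_new_level[of k] Ynew by auto
  qed
  moreover have "Y i \<inter> Y j = {} \<and> (\<exists>u\<in>Y i. \<exists>v\<in>Y j. crosses (Suc k) u v)"
    if ij: "i \<le> Suc k" "j \<le> Suc k" "i \<noteq> j" for i j
  proof -
    consider "i \<le> k" "j \<le> k" | "i \<le> k" "j = Suc k" | "i = Suc k" "j \<le> k" using ij by linarith
    then show ?thesis
    proof cases
      case 1
      obtain u v where "u \<in> X i" "v \<in> X j" "crosses k u v" using disj[OF 1 ij(3)] by blast
      then have "\<exists>u\<in>Y i. \<exists>v\<in>Y j. crosses (Suc k) u v" unfolding Y[OF 1(1)] Y[OF 1(2)] using crosses_old by blast
      moreover have "Y i \<inter> Y j = {}" unfolding Y[OF 1(1)] Y[OF 1(2)] image_Int[OF inj, symmetric]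
        using disj[OF 1 ij(3)] by simp
      ultimately show ?thesis by blast
    next
      case 2
      then show ?thesis using old_new[of i] Ynew by simp
    next
      case 3
      then show ?thesis using old_new[of j] Ynew crosses_sym by blast
    qed
  qed
  ultimately show ?case by (intro exI[of _ Y]) simp
qed

lemma chain_graph_treewidth: "k \<le> treewidth (chain_graph k)"
proof -
  obtain X where X0: "\<forall>i\<le>k. X i \<subseteq> lefts k \<and> X i \<noteq> {} \<and> linked (parcs (chain_graph k)) (X i)"
    and disj0: "\<forall>i\<le>k. \<forall>j\<le>k. i \<noteq> j \<longrightarrow> X i \<inter> X j = {} \<and> (\<exists>u\<in>X i. \<exists>v\<in>X j. crosses k u v)"
    using chain_graph_bramble[of k] by (elim exE conjE) (rule that)
  have X: "X i \<subseteq> lefts k \<and> X i \<noteq> {} \<and> linked (parcs (chain_graph k)) (X i)" if "i \<le> k" for i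
    using X0 that by simp
  have disj: "X i \<inter> X j = {} \<and> (\<exists>u\<in>X i. \<exists>v\<in>X j. crosses k u v)" if "i \<le> k" "j \<le> k" "i \<noteq> j" for i j
    using disj0 that by simp
  show ?thesis
  proof (rule treewidth_ge_bramble[OF pair_graph_chain_graph, of k X])
    fix i j assume ij: "i \<le> k" "j \<le> k" "i \<noteq> j"
    obtain u v where "u \<in> X i" "v \<in> X j" "crosses k u v" using disj[OF ij] by blast
    moreover from this have "(u, v) \<in> parcs (chain_graph k)"
      using X[OF ij(1)] X[OF ij(2)] by (auto simp: chain_graph_def)
    ultimately show "\<exists>u\<in>X i. \<exists>v\<in>X j. (u, v) \<in> parcs (chain_graph k) \<or> (v, u) \<in> parcs (chain_graph k)" by blast
  qed (use X disj in \<open>auto simp: chain_graph_def\<close>)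
qed

theorem theorem21:
  shows "\<not> induced_tw_bounded circle_graphs"
proof
  assume "induced_tw_bounded circle_graphs"
  then obtain f :: "nat \<Rightarrow> nat" where f: "\<forall>t. \<forall>G\<in>circle_graphs. f t \<le> treewidth G \<longrightarrow>
     (\<exists>H. induced_subgraph (with_proj H) (with_proj G) \<and> K\<^bsub>t\<^esub> (with_proj H)) \<or>
     (\<exists>H. induced_subgraph (with_proj H) (with_proj G) \<and> K\<^bsub>t,t\<^esub> (with_proj H)) \<or>
     (\<exists>W. subdivision_pair (wall t) W \<and> contains_induced G W) \<or>
     (\<exists>W. subdivision_pair (wall t) W \<and> contains_induced G (line_graph W))"
    unfolding induced_tw_bounded_def by (elim exE) (rule that)
  \<comment> \<open>Level \<open>f 5\<close> has treewidth at least \<open>f 5\<close>, so the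
    assumed bound applies to it.\<close>
  let ?G = "chain_graph (f 5)"
  note model = chain_graph_chord_model[of "f 5"]
  have "?G \<in> circle_graphs"
    using circle_graph_if_chord_model[OF model pair_graph_chain_graph] by (simp add: circle_graphs_def)
  note alternatives = bspec[OF spec[OF f, of 5] this, THEN mp, OF chain_graph_treewidth]
  have deg: "degenerate 3 (parcs ?G) (pverts ?G)"
    using chain_graph_degenerate[of "f 5"] by (simp add: chain_graph_def)
  have "\<not> K\<^bsub>5\<^esub> (with_proj H)" "\<not> K\<^bsub>5,5\<^esub> (with_proj H)"
    if "induced_subgraph (with_proj H) (with_proj ?G)" for H
    using degenerate_no_complete[OF deg that, of 5] degenerate_no_complete_bipartite[OF deg that, of 5]
    by auto
  moreover have "\<not> contains_induced ?G W" "\<not> contains_induced ?G (line_graph W)"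
    if "subdivision_pair (wall 5) W" for W
    using chord_model_no_wall[OF model that] by auto
  ultimately show False using alternatives by blast
qed

end
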